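(* The satisfiability problem $\textsc{trSat}[\mathcal{T}^{\textsc{fix}}_{\circ}]$ for additive-periodical TE over fixed-width arithmetic is in NEXPTIME.
   Context: A transformer encoder (TE) $T$ over a finite alphabet $\Sigma$ with $L$ layers and $h_i$ attention heads in layer $i$ consists of: a positional embedding $\mathit{emb}\colon\Sigma\times\mathbb{N}\to\mathbb{R}^{d_0}$; for each $1\le i\le L$, $1\le j\le h_i$ an attention head $(\mathit{score}_{i,j},\mathit{pool}_{i,j})$ with scoring $\mathit{score}_{i,j}\colon\mathbb{R}^{d_{i-1}}\times\mathbb{R}^{d_{i-1}}\to\mathbb{R}$ and pooling $\mathit{pool}_{i,j}(\boldsymbol{x}_1,\dots,\boldsymbol{x}_n,s_1,\dots,s_n)=\sum_{i'=1}^n \mathit{norm}_{i,j}(i',s_1,\dots,s_n)\,W_{i,j}\boldsymbol{x}_{i'}$ ($W_{i,j}$ a matrix, $\mathit{norm}_{i,j}$ a normalisation); combination functions $\mathit{comb}_i$; output $\mathit{out}\colon\mathbb{R}^{d_L}\to\mathbb{R}$. On $w=a_1\cdots a_n\in\Sigma^+$: $\boldsymbol{x}^0_m=\mathit{emb}(a_m,m)$; $\boldsymbol{y}^i_{m,j}=\mathit{pool}_{i,j}(\boldsymbol{x}^{i-1}_1,\dots,\boldsymbol{x}^{i-1}_n,\mathit{score}_{i,j}(\boldsymbol{x}^{i-1}_m,\boldsymbol{x}^{i-1}_1),\dots,\mathit{score}_{i,j}(\boldsymbol{x}^{i-1}_m,\boldsymbol{x}^{i-1}_n))$, $\boldsymbol{x}^i_m=\mathit{comb}_i(\boldsymbol{x}^{i-1}_m,\boldsymbol{y}^i_{m,1},\dots,\boldsymbol{y}^i_{m,h_i})$;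 $T(w)=\mathit{out}(\boldsymbol{x}^L_n)$. $\textsc{trSat}[\mathcal{C}]$: given $T\in\mathcal{C}$ over $\Sigma$, decide whether some $w\in\Sigma^+$ has $T(w)=1$. Normalisations: $\mathrm{softmax}(i,s_1,\dots,s_n)=e^{s_i}/\sum_{j}e^{s_j}$; $\mathrm{hardmax}(i,s_1,\dots,s_n)=\frac1m$ if $s_i\ge s_j$ for all $j$, where $m$ is the number of $j$ with $s_j=s_i$, and $0$ otherwise. A fixed-width arithmetic represents numbers in binary with a fixed number $b$ of bits (at most $2^b$ representable rationals), handles overflow by saturation or wrap-around and rounding by rounding up or off; a TE works over it if all values and computations are carried out in it. $\mathcal{T}^{\textsc{fix}}_{\circ}$ is the class of TE $T$ such that: the embedding is additive-periodical, i.e. $\mathit{emb}(a,i)=\mathit{emb}'(a)+\mathit{pos}(i)$ with $\mathit{pos}$ periodic with some period $p\ge1$ ($\mathit{pos}(i)=\mathit{pos}(i+p)$ for all $i$); every normalisation is $\mathrm{softmax}$ or $\mathrm{hardmax}$; and all computations are carried out in a fixed-width arithmetic with $b$ bits. Its complexity is $|T|:=|\Sigma|+L+H+D+p+b$, where $H=\max_i h_i$ and $D$ is the maximal dimensionality of vectors in computations of $T$. Standing assumptions: TE components are computable, the representation size of $T$ is polynomial in $|T|$, and $T(w)$ is computable in time polynomial in $|T|+|w|$. *)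

theory Defs
  imports Complex_Main "HOL-Computational_Algebra.Polynomial"
begin

section \<open>Fixed-width arithmetic\<close>

text \<open>
  An arithmetic is given by its number of bits, its set of representable numbers, and its
  treatment of overflow and of rounding.  Any finite set of at most \<open>2 ^ b\<close> rationals is allowed,
  so fixed-point and floating-point formats are both covered.  Rounding \emph{off} is rounding to
  nearest (ties upwards); since the phrase is also used for cutting off the surplus digits,
  rounding down is admitted as well.

  Wrap-around identifies numbers that differ by a multiple of a modulus \<open>M\<close>; for two's complement
  fixed-point numbers \<open>M\<close> is the largest minus the smallest number plus one unit in the last place.
\<close>

datatype overflow = Saturate | Wrap (modulus: real)

datatype rounding = Round_Up | Round_Off | Round_Down

record arithmetic =
  bits :: nat
  nums :: "real set"
  ovf :: overflow
  rnd :: rounding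

definition fixed_width :: "arithmetic \<Rightarrow> bool" where
  "fixed_width A \<longleftrightarrow>
     finite (nums A) \<and> nums A \<noteq> {} \<and> nums A \<subseteq> \<rat> \<and> card (nums A) \<le> 2 ^ bits A \<and>
     (\<forall>M. ovf A = Wrap M \<longrightarrow> Max (nums A) - Min (nums A) < M)"

text \<open>Rounding of \<open>x\<close> to the finite set \<open>S\<close>, where \<open>Min S \<le> x \<le> Max S\<close>.\<close>

definition round_to :: "rounding \<Rightarrow> real set \<Rightarrow> real \<Rightarrow> real" where
  "round_to r S x =
     (let u = Min {y \<in> S. x \<le> y}; d = Max {y \<in> S. y \<le> x} in
      case r of
        Round_Up \<Rightarrow> u
      | Round_Off \<Rightarrow> (if u - x \<le> x - d then u else d)
      | Round_Down \<Rightarrow> d)"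

text \<open>
  The number that represents the real \<open>x\<close>.  Under wrap-around, \<open>x\<close> is first reduced to the interval
  from \<open>m = Min (nums A)\<close> (inclusive) to \<open>m + M\<close> (exclusive), and \<open>m + M\<close>, the next copy of \<open>m\<close>, is
  a possible target of the rounding.
\<close>

definition rd :: "arithmetic \<Rightarrow> real \<Rightarrow> real" where
  "rd A x =
     (let m = Min (nums A) in
      case ovf A of
        Saturate \<Rightarrow> round_to (rnd A) (nums A) (max m (min (Max (nums A)) x))
      | Wrap M \<Rightarrow>
          (let y = round_to (rnd A) (insert (m + M) (nums A)) (x - M * of_int \<lfloor>(x - m) / M\<rfloor>)
           in if y = m + M then m else y))"

lemma round_to_in:
  assumes "finite S" "a \<in> S" "a \<le> x" "b \<in> S" "x \<le> b"
  shows "round_to r S x \<in> S"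
proof -
  have "Min {y \<in> S. x \<le> y} \<in> {y \<in> S. x \<le> y}" by (rule Min_in) (use assms in auto)
  moreover have "Max {y \<in> S. y \<le> x} \<in> {y \<in> S. y \<le> x}" by (rule Max_in) (use assms in auto)
  ultimately show ?thesis by (auto simp: round_to_def Let_def split: rounding.split)
qed

lemma rd_in:
  assumes "fixed_width A"
  shows "rd A x \<in> nums A"
proof -
  define m where "m = Min (nums A)"
  have fin: "finite (nums A)" and ne: "nums A \<noteq> {}"
    using assms by (auto simp: fixed_width_def)
  have m: "m \<in> nums A" and mx: "Max (nums A) \<in> nums A" and le: "m \<le> Max (nums A)"
    unfolding m_def using fin ne by auto
  show ?thesis
  proof (cases "ovf A")
    case Saturate
    have "round_to (rnd A) (nums A) (max m (min (Max (nums A)) x)) \<in> nums A"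
      by (rule round_to_in[OF fin m _ mx]) (use le in auto)
    then show ?thesis by (simp add: rd_def Saturate m_def Let_def)
  next
    case (Wrap M)
    then have "Max (nums A) - m < M" using assms by (simp add: fixed_width_def m_def)
    then have M: "0 < M" using le by linarith
    define k :: real where "k = of_int \<lfloor>(x - m) / M\<rfloor>"
    have "k \<le> (x - m) / M" "(x - m) / M < k + 1" unfolding k_def by linarith+
    then have "m \<le> x - M * k" "x - M * k \<le> m + M"
      using M by (simp_all add: pos_le_divide_eq pos_divide_less_eq algebra_simps)
    then have "round_to (rnd A) (insert (m + M) (nums A)) (x - M * k) \<in> insert (m + M) (nums A)"
      by (intro round_to_in[of _ m _ "m + M"]) (use fin m in auto)
    then show ?thesis using m by (auto simp: rd_def Wrap m_def k_def Let_def)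
  qed
qed

lemma rd_id:
  assumes "fixed_width A" "x \<in> nums A"
  shows "rd A x = x"
proof -
  have fin: "finite (nums A)" using assms by (auto simp: fixed_width_def)
  have bd: "Min (nums A) \<le> x" "x \<le> Max (nums A)" using fin assms(2) by auto
  have r: "round_to r S x = x" if "finite S" "x \<in> S" for r S
  proof -
    have "Min {y \<in> S. x \<le> y} = x" "Max {y \<in> S. y \<le> x} = x"
      using that by (auto intro!: Min_eqI Max_eqI)
    then show ?thesis by (simp add: round_to_def split: rounding.split)
  qed
  show ?thesis
  proof (cases "ovf A")
    case Saturate
    then show ?thesis using bd r[OF fin assms(2)] by (simp add: rd_def Let_def max_def min_def)
  next
    case (Wrap M)
    then have M: "Max (nums A) - Min (nums A) < M" using assms by (auto simp: fixed_width_def)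
    then have "0 \<le> (x - Min (nums A)) / M" "(x - Min (nums A)) / M < 1"
      using bd by (auto simp: field_simps)
    then have "\<lfloor>(x - Min (nums A)) / M\<rfloor> = 0" by linarith
    moreover have "x \<noteq> Min (nums A) + M" using M bd by auto
    ultimately show ?thesis using r[of "insert (Min (nums A) + M) (nums A)"] fin assms(2)
      by (simp add: rd_def Wrap Let_def)
  qed
qed


section \<open>Transformer encoders\<close>

text \<open>
  Vectors are lists, matrices are lists of rows.  The operations take a rounding function \<open>f\<close> that is
  applied to the result of every arithmetic operation: \<open>f = rd A\<close> carries the computation out in the
  arithmetic \<open>A\<close>, and \<open>f = (\<lambda>x. x)\<close> is exact real arithmetic (see the lemmas below).  Sums are
  evaluated from left to right.  List positions start from 0, positions in a word from 1.
\<close>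

type_synonym rvec = "real list"

definition fsum :: "(real \<Rightarrow> real) \<Rightarrow> real list \<Rightarrow> real" where
  "fsum f xs = foldl (\<lambda>s x. f (s + x)) 0 xs"

definition fadd :: "(real \<Rightarrow> real) \<Rightarrow> rvec \<Rightarrow> rvec \<Rightarrow> rvec" where
  "fadd f u v = map2 (\<lambda>x y. f (x + y)) u v"

definition fmult :: "(real \<Rightarrow> real) \<Rightarrow> real list list \<Rightarrow> rvec \<Rightarrow> rvec" where
  "fmult f W x = map (\<lambda>r. fsum f (map2 (\<lambda>u v. f (u * v)) r x)) W"

definition softmax :: "(real \<Rightarrow> real) \<Rightarrow> nat \<Rightarrow> real list \<Rightarrow> real" where
  "softmax f i ss = f (f (exp (ss ! i)) / fsum f (map (\<lambda>s. f (exp s)) ss))"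

definition hardmax :: "(real \<Rightarrow> real) \<Rightarrow> nat \<Rightarrow> real list \<Rightarrow> real" where
  "hardmax f i ss =
     (if \<forall>j<length ss. ss ! j \<le> ss ! i
      then f (1 / fsum f (map (\<lambda>_. f 1) (filter (\<lambda>s. s = ss ! i) ss)))
      else f 0)"

lemma fsum_exact: "fsum (\<lambda>x. x) xs = sum_list xs"
proof -
  have "foldl (+) a xs = a + sum_list xs" for a :: real by (induction xs arbitrary: a) auto
  then show ?thesis by (simp add: fsum_def)
qed

lemma softmax_exact:
  "softmax (\<lambda>x. x) i ss = exp (ss ! i) / (\<Sum>j<length ss. exp (ss ! j))"
  by (simp add: softmax_def fsum_exact sum_list_sum_nth atLeast0LessThan)

lemma hardmax_exact:
  "hardmax (\<lambda>x. x) i ss =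
     (if \<forall>j<length ss. ss ! j \<le> ss ! i
      then 1 / real (card {j. j < length ss \<and> ss ! j = ss ! i}) else 0)"
  unfolding hardmax_def fsum_exact sum_list_triv length_filter_conv_card by (rule if_cong) simp_all

record head =
  score :: "rvec \<Rightarrow> rvec \<Rightarrow> real"
  weight :: "real list list"
  normalisation :: "nat \<Rightarrow> real list \<Rightarrow> real"

record layer =
  heads :: "head list"
  comb :: "rvec \<Rightarrow> rvec list \<Rightarrow> rvec"
  out_dim :: nat

text \<open>The alphabet of an encoder consists of the letters \<open>0, \<dots>, alph_size - 1\<close>.\<close>

record te =
  alph_size :: nat
  dim0 :: nat
  emb :: "nat \<Rightarrow> nat \<Rightarrow> rvec"
  layers :: "layer list"
  out :: "rvec \<Rightarrow> real"

definition pool :: "(real \<Rightarrow> real) \<Rightarrow> head \<Rightarrow> rvec list \<Rightarrow> real list \<Rightarrow> rvec" where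
  "pool f h xs ss =
     map (\<lambda>r. fsum f (map (\<lambda>i. f (normalisation h i ss * fmult f (weight h) (xs ! i) ! r))
                          [0..<length xs]))
       [0..<length (weight h)]"

definition apply_layer :: "(real \<Rightarrow> real) \<Rightarrow> layer \<Rightarrow> rvec list \<Rightarrow> rvec list" where
  "apply_layer f l xs =
     map (\<lambda>x. comb l x (map (\<lambda>h. pool f h xs (map (score h x) xs)) (heads l))) xs"

definition te_eval :: "(real \<Rightarrow> real) \<Rightarrow> 'a te_scheme \<Rightarrow> nat list \<Rightarrow> real" where
  "te_eval f T w =
     out T (last (foldl (\<lambda>xs l. apply_layer f l xs)
                        (map2 (emb T) w [1..<Suc (length w)])
                        (layers T)))"


section \<open>Additive-periodical encoders over fixed-width arithmetic\<close>

record fix_te = te +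
  arith :: arithmetic
  period :: nat

definition vecs :: "arithmetic \<Rightarrow> nat \<Rightarrow> rvec set" where
  "vecs A d = {x. length x = d \<and> set x \<subseteq> nums A}"

definition fix_head :: "arithmetic \<Rightarrow> nat \<Rightarrow> head \<Rightarrow> bool" where
  "fix_head A d h \<longleftrightarrow>
     (\<forall>x\<in>vecs A d. \<forall>y\<in>vecs A d. score h x y \<in> nums A) \<and>
     set (weight h) \<subseteq> vecs A d \<and>
     normalisation h \<in> {softmax (rd A), hardmax (rd A)}"

definition fix_layer :: "arithmetic \<Rightarrow> nat \<Rightarrow> layer \<Rightarrow> bool" where
  "fix_layer A d l \<longleftrightarrow>
     (\<forall>h\<in>set (heads l). fix_head A d h) \<and>
     (\<forall>x\<in>vecs A d. \<forall>ys.
        list_all2 (\<lambda>h y. y \<in> vecs A (length (weight h))) (heads l) ys \<longrightarrow>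
        comb l x ys \<in> vecs A (out_dim l))"

text \<open>\<open>dims T ! i\<close> is the dimension of the vectors after \<open>i\<close> layers.\<close>

definition dims :: "'a te_scheme \<Rightarrow> nat list" where
  "dims T = dim0 T # map out_dim (layers T)"

definition additive_periodical :: "fix_te \<Rightarrow> bool" where
  "additive_periodical T \<longleftrightarrow>
     1 \<le> period T \<and>
     (\<exists>emb' pos.
        (\<forall>a<alph_size T. emb' a \<in> vecs (arith T) (dim0 T)) \<and>
        (\<forall>i. pos i \<in> vecs (arith T) (dim0 T)) \<and>
        (\<forall>i. pos i = pos (i + period T)) \<and>
        (\<forall>a<alph_size T. \<forall>i. emb T a i = fadd (rd (arith T)) (emb' a) (pos i)))"

definition T_fix :: "fix_te set" where
  "T_fix = {T. fixed_width (arith T) \<and> additive_periodical T \<and>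
     (\<forall>i<length (layers T). fix_layer (arith T) (dims T ! i) (layers T ! i)) \<and>
     (\<forall>x\<in>vecs (arith T) (last (dims T)). out T x \<in> nums (arith T))}"

definition max_heads :: "'a te_scheme \<Rightarrow> nat" where
  "max_heads T = Max (insert 0 ((\<lambda>l. length (heads l)) ` set (layers T)))"

text \<open>The pooled vectors have as many entries as the matrix of the head has rows.\<close>

definition max_dim :: "'a te_scheme \<Rightarrow> nat" where
  "max_dim T = Max (set (dims T) \<union> {length (weight h) |l h. l \<in> set (layers T) \<and> h \<in> set (heads l)})"

definition complexity :: "fix_te \<Rightarrow> nat" where
  "complexity T =
     alph_size T + length (layers T) + max_heads T + max_dim T + period T + bits (arith T)"

definition words :: "'a te_scheme \<Rightarrow> nat list set" where
  "words T = {w. w \<noteq> [] \<and> set w \<subseteq> {..<alph_size T}}"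

definition fix_eval :: "fix_te \<Rightarrow> nat list \<Rightarrow> real" where
  "fix_eval T w = te_eval (rd (arith T)) T w"

definition satisfiable :: "fix_te \<Rightarrow> bool" where
  "satisfiable T \<longleftrightarrow> (\<exists>w\<in>words T. fix_eval T w = 1)"


section \<open>Turing machines\<close>

text \<open>
  Nondeterministic multi-tape machines with two-way infinite tapes.  A transition
  \<open>(q, rs, q', as)\<close> applies in state \<open>q\<close> when the heads read \<open>rs\<close>; it changes to state \<open>q'\<close> and
  performs on each tape an action, i.e. a symbol to write and a head movement.  States and symbols are
  natural numbers; finiteness of the transition relation makes only finitely many of them relevant.
  Symbol 0 is the blank, 1 and 2 stand for the bits.
\<close>

record tm =
  tapes :: nat
  start :: nat
  accept :: nat
  trans :: "(nat \<times> nat list \<times> nat \<times> (nat \<times> int) list) set"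

definition wf_tm :: "tm \<Rightarrow> bool" where
  "wf_tm M \<longleftrightarrow> 1 \<le> tapes M \<and> finite (trans M) \<and>
     (\<forall>(q, rs, q', as)\<in>trans M.
        length rs = tapes M \<and> length as = tapes M \<and> snd ` set as \<subseteq> {-1, 0, 1})"

definition deterministic :: "tm \<Rightarrow> bool" where
  "deterministic M \<longleftrightarrow>
     (\<forall>q rs c c'. (q, rs, c) \<in> trans M \<and> (q, rs, c') \<in> trans M \<longrightarrow> c = c')"

type_synonym tape = "(int \<Rightarrow> nat) \<times> int"

type_synonym config = "nat \<times> tape list"

definition step :: "tm \<Rightarrow> config \<Rightarrow> config \<Rightarrow> bool" where
  "step M c c' \<longleftrightarrow>
     (\<exists>as. (fst c, map (\<lambda>(t, p). t p) (snd c), fst c', as) \<in> trans M \<and>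
           snd c' = map2 (\<lambda>(t, p) (s, d). (t(p := s), p + d)) (snd c) as)"

text \<open>The tape that holds the string \<open>xs\<close> and is otherwise blank, with the head on the first cell.\<close>

definition tape_of :: "bool list \<Rightarrow> tape" where
  "tape_of xs =
     (\<lambda>i. if 0 \<le> i \<and> nat i < length xs then (if xs ! nat i then 2 else 1) else 0, 0)"

definition init_config :: "tm \<Rightarrow> bool list list \<Rightarrow> config" where
  "init_config M ins =
     (start M, map (\<lambda>k. tape_of (if k < length ins then ins ! k else [])) [0..<tapes M])"

definition accepts_within :: "tm \<Rightarrow> bool list \<Rightarrow> nat \<Rightarrow> bool" where
  "accepts_within M x n \<longleftrightarrow>
     (\<exists>k\<le>n. \<exists>c. (step M ^^ k) (init_config M [x]) c \<and> fst c = accept M)"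

text \<open>The inputs are on the first tapes; the output is expected on the tape that follows them.\<close>

definition computes_within :: "tm \<Rightarrow> bool list list \<Rightarrow> bool list \<Rightarrow> nat \<Rightarrow> bool" where
  "computes_within M ins res n \<longleftrightarrow>
     length ins < tapes M \<and>
     (\<exists>k\<le>n. \<exists>c. (step M ^^ k) (init_config M ins) c \<and> (\<nexists>c'. step M c c') \<and>
              snd c ! length ins = tape_of res)"

text \<open>
  NEXPTIME for promise problems, given by the sets of yes- and no-instances; strings that encode no
  instance belong to neither set.  As in Garey and Johnson, the time a nondeterministic machine needs
  to accept an input is the length of a shortest accepting computation; because the bounds
  \<open>2 ^ poly p n\<close> are time-constructible, it makes no difference for the class whether all other
  computations are required to halt within the bound, too.
\<close>

definition NEXPTIME :: "(bool list set \<times> bool list set) set" where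
  "NEXPTIME = {(Y, N). \<exists>M (p :: nat poly). wf_tm M \<and>
     (\<forall>x\<in>Y. accepts_within M x (2 ^ poly p (length x))) \<and>
     (\<forall>x\<in>N. \<forall>n. \<not> accepts_within M x n)}"


section \<open>The satisfiability problem\<close>

definition unary :: "nat \<Rightarrow> bool list" where
  "unary n = replicate n True @ [False]"

definition word_code :: "nat list \<Rightarrow> bool list" where
  "word_code w = concat (map unary w)"

text \<open>
  The components of an encoder are arbitrary functions, so a class of encoders is an input to a machine
  only through a representation.  A representation \<open>den\<close> maps descriptions, i.e. bit strings, to
  the encoders they denote.  An instance consists of the six parameters that make up the complexity,
  in unary, followed by a description.
\<close>

definition instance_code :: "bool list \<Rightarrow> fix_te \<Rightarrow> bool list" where
  "instance_code x T =
     concat (map unary [alph_size T, length (layers T), max_heads T, max_dim T, period T,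
                        bits (arith T)]) @ x"

definition poly_size :: "(bool list \<rightharpoonup> fix_te) \<Rightarrow> bool" where
  "poly_size den \<longleftrightarrow>
     (\<exists>p :: nat poly. \<forall>x T. den x = Some T \<longrightarrow> length x \<le> poly p (complexity T))"

text \<open>The code \<open>num\<close> of the output values is arbitrary, but the same for all encoders of the class.\<close>

definition poly_time_eval :: "(bool list \<rightharpoonup> fix_te) \<Rightarrow> bool" where
  "poly_time_eval den \<longleftrightarrow>
     (\<exists>M num (p :: nat poly). wf_tm M \<and> deterministic M \<and> inj_on num \<rat> \<and>
        (\<forall>x T w. den x = Some T \<and> w \<in> words T \<longrightarrow>
           computes_within M [instance_code x T, word_code w] (num (fix_eval T w))
             (poly p (complexity T + length w))))"

definition trSat :: "(bool list \<rightharpoonup> fix_te) \<Rightarrow> bool list set \<times> bool list set" where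
  "trSat den =
     ({instance_code x T |x T. den x = Some T \<and> satisfiable T},
      {instance_code x T |x T. den x = Some T \<and> \<not> satisfiable T})"

end

theory Submission
  imports Defs "HOL-Library.FuncSet" "HOL-Library.Countable"
begin

text \<open>
  Since the positional embedding has period \<open>p\<close>, the vector at a position depends only on its class,
  the pair of its letter and its index modulo \<open>p\<close>; by induction this persists through all layers, as
  attention adds only a dependence on the word as a whole.  There are at most \<open>|\<Sigma>| p\<close> classes, so each
  layer answers only polynomially many distinct attention queries.  Each rounded sum in such an answer
  is a left-to-right fold along the word that takes at most \<open>2 ^ b + 1\<close> values.  If two prefixes
  agree in their length modulo \<open>p\<close>, in the set of their classes and in the values of all these folds, then
  the part between them can be cut out without changing the output.  By the pigeonhole principle a
  shortest accepted word has exponential length at most.  A nondeterministic machine guesses such a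
  word and runs the given evaluator on it.
\<close>

text \<open>Rounding after every addition makes sums depend on the order of summation, so counting
  how often each class occurs need not determine a pooled vector; what can be compared is the
  running value of a sum on a prefix. These sums are nested: a pooled sum uses a normaliser known
  only after a pass over the whole word, and a higher layer uses the results of the lower ones. The
  family of folds is therefore chosen for one fixed word, and the final values on that word are
  built into the step functions as constants. For another word with the same classes and the same
  final values these constants turn out correct one after the other, so the numbers of folds add up
  over the layers instead of the state spaces being nested. On the machine side the output code
  \<open>num\<close> is arbitrary, so the result of the evaluator cannot be decoded. It is compared
  cell by cell with the fixed string \<open>num 1\<close>. Since \<open>num\<close> is injective
  only on the rationals, the proof also has to show that outputs are rational.\<close>

subsection \<open>Short accepted words\<close>

text \<open>The set of all scores is an argument of \<open>\<delta>\<close> because hardmax has to know their maximum.\<close>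

lemma normalisation_fold:
  assumes "n \<in> {softmax f, hardmax f}"
  obtains \<delta> \<mu> where "\<And>S s (x :: real). \<delta> S s x \<in> insert s (range f)"
    and "\<And>i ss. i < length ss \<Longrightarrow> n i ss = \<mu> (set ss) (foldl (\<delta> (set ss)) 0 ss) (ss ! i)"
proof (cases "n = softmax f")
  case True
  show ?thesis
    by (rule that[of "\<lambda>S s x. f (s + f (exp x))" "\<lambda>S Z x. f (f (exp x) / Z)"])
      (simp_all add: True softmax_def fsum_def foldl_map)
next
  case False
  then have n: "n = hardmax f" using assms by simp
  \<comment> \<open>Counting the occurrences of \<open>Max S\<close> serves all indices at once:
    \<open>\<mu>\<close> consults the count only at a maximal score, and there
    \<open>ss ! i = Max S\<close>.\<close>
  define \<delta> where "\<delta> S s x = (if x = Max S then f (s + f 1) else s)" for S s and x :: real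
  have fold: "foldl (\<lambda>s _. f (s + f 1)) a (filter (\<lambda>x. x = Max S) ss) = foldl (\<delta> S) a ss" for a S ss
    by (induction ss arbitrary: a) (simp_all add: \<delta>_def)
  show ?thesis
  proof (rule that[of \<delta> "\<lambda>S Z x. if \<forall>y\<in>S. y \<le> x then f (1 / Z) else f 0"])
    show "\<delta> S s x \<in> insert s (range f)" for S s x by (simp add: \<delta>_def)
    fix i :: nat and ss :: "real list"
    assume i: "i < length ss"
    have all: "(\<forall>j<length ss. ss ! j \<le> ss ! i) \<longleftrightarrow> (\<forall>y\<in>set ss. y \<le> ss ! i)"
      by (metis in_set_conv_nth)
    show "n i ss = (if \<forall>y\<in>set ss. y \<le> ss ! i
        then f (1 / foldl (\<delta> (set ss)) 0 ss) else f 0)"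
    proof (cases "\<forall>y\<in>set ss. y \<le> ss ! i")
      case True
      then have "ss ! i = Max (set ss)" using i by (intro Max_eqI[symmetric]) auto
      then show ?thesis
        using True fold[of 0 "set ss" ss] unfolding n hardmax_def all
        by (simp add: fsum_def foldl_map)
    next
      case False
      then show ?thesis unfolding n hardmax_def all by presburger
    qed
  qed
qed

text \<open>
  The result of a step is taken from \<open>insert s (range f)\<close> because the count of a hardmax passes over the
  scores below the maximum, and the initial value 0 need not be representable.
\<close>

definition fold_determined ::
  "(real \<Rightarrow> real) \<Rightarrow> 'c list \<Rightarrow> nat \<Rightarrow> ('c list \<Rightarrow> bool) \<Rightarrow> bool" where
  "fold_determined f cs N P \<longleftrightarrow>
     (\<exists>\<Phi>. finite \<Phi> \<and> card \<Phi> \<le> N \<and> (\<forall>\<delta>\<in>\<Phi>. \<forall>s c. \<delta> s c \<in> insert s (range f)) \<and>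
        (\<forall>cs'. set cs' = set cs \<longrightarrow> (\<forall>\<delta>\<in>\<Phi>. foldl \<delta> 0 cs' = foldl \<delta> 0 cs) \<longrightarrow> P cs'))"

lemma fold_determined_mono:
  assumes "fold_determined f cs N P" "N \<le> N'"
    and "\<And>cs'. set cs' = set cs \<Longrightarrow> P cs' \<Longrightarrow> Q cs'"
  shows "fold_determined f cs N' Q"
  using assms unfolding fold_determined_def by (meson order.trans)

lemma fold_determined_ball:
  assumes I: "finite I" and P: "\<And>i. i \<in> I \<Longrightarrow> fold_determined f cs N (P i)"
  shows "fold_determined f cs (card I * N) (\<lambda>cs'. \<forall>i\<in>I. P i cs')"
proof -
  have "\<forall>i\<in>I. \<exists>\<Phi>. finite \<Phi> \<and> card \<Phi> \<le> N \<and> (\<forall>\<delta>\<in>\<Phi>. \<forall>s c. \<delta> s c \<in> insert s (range f)) \<and>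
        (\<forall>cs'. set cs' = set cs \<longrightarrow> (\<forall>\<delta>\<in>\<Phi>. foldl \<delta> 0 cs' = foldl \<delta> 0 cs) \<longrightarrow> P i cs')"
    using P unfolding fold_determined_def by blast
  then obtain F where F: "\<forall>i\<in>I. finite (F i) \<and> card (F i) \<le> N \<and>
        (\<forall>\<delta>\<in>F i. \<forall>s c. \<delta> s c \<in> insert s (range f)) \<and>
        (\<forall>cs'. set cs' = set cs \<longrightarrow> (\<forall>\<delta>\<in>F i. foldl \<delta> 0 cs' = foldl \<delta> 0 cs) \<longrightarrow> P i cs')"
    by (rule bchoice[THEN exE])
  have "card (\<Union>i\<in>I. F i) \<le> (\<Sum>i\<in>I. card (F i))" using I by (rule card_UN_le)
  also have "\<dots> \<le> (\<Sum>i\<in>I. N)" using F by (intro sum_mono) blast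
  finally have "card (\<Union>i\<in>I. F i) \<le> card I * N" by simp
  then show ?thesis
    unfolding fold_determined_def by (intro exI[of _ "\<Union>i\<in>I. F i"]) (use F I in auto)
qed

lemma fold_determined_conj:
  assumes "fold_determined f cs M P" "fold_determined f cs N Q"
  shows "fold_determined f cs (M + N) (\<lambda>cs'. P cs' \<and> Q cs')"
proof -
  obtain \<Phi> where \<Phi>: "finite \<Phi>" "card \<Phi> \<le> M" "\<forall>\<delta>\<in>\<Phi>. \<forall>s c. \<delta> s c \<in> insert s (range f)"
    "\<forall>cs'. set cs' = set cs \<longrightarrow> (\<forall>\<delta>\<in>\<Phi>. foldl \<delta> 0 cs' = foldl \<delta> 0 cs) \<longrightarrow> P cs'"
    using assms(1) unfolding fold_determined_def by blast
  obtain \<Psi> where \<Psi>: "finite \<Psi>" "card \<Psi> \<le> N" "\<forall>\<delta>\<in>\<Psi>. \<forall>s c. \<delta> s c \<in> insert s (range f)"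
    "\<forall>cs'. set cs' = set cs \<longrightarrow> (\<forall>\<delta>\<in>\<Psi>. foldl \<delta> 0 cs' = foldl \<delta> 0 cs) \<longrightarrow> Q cs'"
    using assms(2) unfolding fold_determined_def by blast
  have "card (\<Phi> \<union> \<Psi>) \<le> M + N" using card_Un_le[of \<Phi> \<Psi>] \<Phi>(2) \<Psi>(2) by linarith
  then show ?thesis
    unfolding fold_determined_def by (intro exI[of _ "\<Phi> \<union> \<Psi>"] conjI allI impI)
      (use \<Phi>(1,3,4) \<Psi>(1,3,4) in blast)+
qed

text \<open>One fold accumulates the state of the normalisation, and one further fold per row of the
  weight matrix sums an entry of the pooled vector; hence the successor.\<close>

lemma fold_determined_pool:
  fixes g :: "'c \<Rightarrow> rvec"
  assumes "normalisation h \<in> {softmax f, hardmax f}"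
  shows "fold_determined f cs (Suc (length (weight h)))
    (\<lambda>cs'. pool f h (map g cs') (map (score h x) (map g cs')) =
       pool f h (map g cs) (map (score h x) (map g cs)))"
proof -
  obtain \<delta> \<mu> where \<delta>: "\<And>S s x. \<delta> S s x \<in> insert s (range f)"
    and \<mu>: "\<And>i ss. i < length ss \<Longrightarrow>
      normalisation h i ss = \<mu> (set ss) (foldl (\<delta> (set ss)) 0 ss) (ss ! i)"
    using normalisation_fold[OF assms] by blast
  define sc where "sc c = score h x (g c)" for c
  define S where "S = sc ` set cs"
  define d where "d s c = \<delta> S s (sc c)" for s c
  define e where "e Z r s c = f (s + f (\<mu> S Z (sc c) * fmult f (weight h) (g c) ! r))"
    for Z r s c
  have pool: "pool f h (map g cs') (map (score h x) (map g cs')) =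
      map (\<lambda>r. foldl (e (foldl d 0 cs') r) 0 cs') [0..<length (weight h)]"
    if "set cs' = set cs" for cs'
  proof -
    have set: "set (map (score h x) (map g cs')) = S"
      using that by (auto simp: S_def sc_def)
    have "map (\<lambda>i. f (normalisation h i (map (score h x) (map g cs')) *
             fmult f (weight h) (map g cs' ! i) ! r)) [0..<length (map g cs')] =
        map (\<lambda>c. f (\<mu> S (foldl d 0 cs') (sc c) * fmult f (weight h) (g c) ! r)) cs'" for r
      by (rule nth_equalityI)
        (simp_all add: \<mu> set[simplified] foldl_map d_def[abs_def] sc_def)
    then show ?thesis
      by (simp add: pool_def fsum_def foldl_map e_def[abs_def])
  qed
  \<comment> \<open>The row folds carry the normalisation state of \<open>cs\<close> as a constant.
    A \<open>cs'\<close> that agrees with \<open>cs\<close> on \<open>d\<close> has this same state,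
    so the constant is right for \<open>cs'\<close> too.\<close>
  let ?\<Phi> = "insert d (e (foldl d 0 cs) ` {..<length (weight h)})"
  have "card ?\<Phi> \<le> Suc (length (weight h))"
    using card_image_le[of "{..<length (weight h)}" "e (foldl d 0 cs)"]
    by (simp add: card_insert_if)
  moreover have "\<gamma> s c \<in> insert s (range f)" if "\<gamma> \<in> ?\<Phi>" for \<gamma> s c
    using that
  proof
    assume "\<gamma> = d"
    then show ?thesis unfolding d_def using \<delta> by blast
  qed (auto simp: e_def)
  moreover have "pool f h (map g cs') (map (score h x) (map g cs')) =
       pool f h (map g cs) (map (score h x) (map g cs))"
    if "set cs' = set cs" and "\<forall>\<gamma>\<in>?\<Phi>. foldl \<gamma> 0 cs' = foldl \<gamma> 0 cs" for cs'
    unfolding pool[OF that(1)] pool[OF refl] using that(2) by simp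
  ultimately show ?thesis
    unfolding fold_determined_def by (intro exI[of _ ?\<Phi>]) blast
qed

text \<open>Attention queries come only from classes in \<open>set cs\<close>, one per class and
  head. With the answers taken from \<open>cs\<close>, the new vector is again a function
  \<open>g'\<close> of the class, and the folds force the same answers on
  \<open>cs'\<close>.\<close>

lemma fold_determined_layer:
  fixes g :: "'c \<Rightarrow> rvec"
  assumes norm: "\<And>h. h \<in> set (heads l) \<Longrightarrow> normalisation h \<in> {softmax f, hardmax f}"
    and H: "length (heads l) \<le> H" and D: "\<And>h. h \<in> set (heads l) \<Longrightarrow> length (weight h) \<le> D"
  shows "\<exists>g'. fold_determined f cs (card (set cs) * (H * Suc D))
    (\<lambda>cs'. apply_layer f l (map g cs') = map g' cs')"
proof -
  define P where "P c h cs' \<longleftrightarrow> pool f h (map g cs') (map (score h (g c)) (map g cs')) =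
       pool f h (map g cs) (map (score h (g c)) (map g cs))" for c h cs'
  have "fold_determined f cs (Suc D) (P c h)" if "h \<in> set (heads l)" for c h
    by (rule fold_determined_mono[OF fold_determined_pool[OF norm[OF that], of cs g "g c"]])
      (use D[OF that] in \<open>simp_all add: P_def\<close>)
  then have *: "fold_determined f cs (card (set cs) * (card (set (heads l)) * Suc D))
      (\<lambda>cs'. \<forall>c\<in>set cs. \<forall>h\<in>set (heads l). P c h cs')"
    by (intro fold_determined_ball) auto
  define g' where "g' c = comb l (g c)
     (map (\<lambda>h. pool f h (map g cs) (map (score h (g c)) (map g cs))) (heads l))" for c
  have "card (set cs) * (card (set (heads l)) * Suc D) \<le> card (set cs) * (H * Suc D)"
    using card_length[of "heads l"] H by (intro mult_le_mono) auto
  with * have "fold_determined f cs (card (set cs) * (H * Suc D))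
    (\<lambda>cs'. apply_layer f l (map g cs') = map g' cs')"
    by (rule fold_determined_mono)
      (auto simp: P_def apply_layer_def g'_def o_def intro!: arg_cong[where f = "comb l _"])
  then show ?thesis by (rule exI[of _ g'])
qed

text \<open>The first layer fixes \<open>g1\<close> from \<open>cs\<close> alone, and the remaining
  layers get a family built for \<open>g1\<close>. The families are united, so the number of folds
  is linear in the number of layers.\<close>

lemma fold_determined_layers:
  fixes g :: "'c \<Rightarrow> rvec"
  assumes "\<And>l h. l \<in> set ls \<Longrightarrow> h \<in> set (heads l) \<Longrightarrow> normalisation h \<in> {softmax f, hardmax f}"
    and "\<And>l. l \<in> set ls \<Longrightarrow> length (heads l) \<le> H"
    and "\<And>l h. l \<in> set ls \<Longrightarrow> h \<in> set (heads l) \<Longrightarrow> length (weight h) \<le> D"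
  shows "\<exists>g'. fold_determined f cs (length ls * (card (set cs) * (H * Suc D)))
    (\<lambda>cs'. foldl (\<lambda>xs l. apply_layer f l xs) (map g cs') ls = map g' cs')"
  using assms
proof (induction ls arbitrary: g)
  case Nil
  show ?case by (intro exI[of _ g]) (auto simp: fold_determined_def intro!: exI[of _ "{}"])
next
  case (Cons l ls)
  let ?N = "card (set cs) * (H * Suc D)"
  have "\<exists>g1. fold_determined f cs ?N (\<lambda>cs'. apply_layer f l (map g cs') = map g1 cs')"
    by (rule fold_determined_layer) (rule Cons.prems[OF list.set_intros(1)], assumption?)+
  then obtain g1 where
    1: "fold_determined f cs ?N (\<lambda>cs'. apply_layer f l (map g cs') = map g1 cs')" ..
  have "\<exists>g2. fold_determined f cs (length ls * ?N)
      (\<lambda>cs'. foldl (\<lambda>xs l. apply_layer f l xs) (map g1 cs') ls = map g2 cs')"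
    by (rule Cons.IH) (rule Cons.prems[OF list.set_intros(2)], assumption+)+
  then obtain g2 where 2: "fold_determined f cs (length ls * ?N)
      (\<lambda>cs'. foldl (\<lambda>xs l. apply_layer f l xs) (map g1 cs') ls = map g2 cs')" ..
  have "fold_determined f cs (length (l # ls) * ?N)
      (\<lambda>cs'. foldl (\<lambda>xs l. apply_layer f l xs) (map g cs') (l # ls) = map g2 cs')"
    by (rule fold_determined_mono[OF fold_determined_conj[OF 1 2]]) simp_all
  then show ?case by (rule exI[of _ g2])
qed

section \<open>Classes of positions and the cut\<close>

definition classes :: "nat \<Rightarrow> nat list \<Rightarrow> (nat \<times> nat) list" where
  "classes p w = map2 (\<lambda>a i. (a, i mod p)) w [1..<Suc (length w)]"

lemma length_classes [simp]: "length (classes p w) = length w"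
  by (simp add: classes_def del: upt_Suc)

lemma nth_classes [simp]: "i < length w \<Longrightarrow> classes p w ! i = (w ! i, Suc i mod p)"
  by (simp add: classes_def del: upt_Suc)

text \<open>The suffix is shifted by \<open>m' - m\<close>, a multiple of \<open>p\<close>, so its
  residues do not change.\<close>

lemma classes_cut:
  assumes "m \<le> m'" "m' \<le> length w" "m mod p = m' mod p"
  shows "classes p (take m w @ drop m' w) = take m (classes p w) @ drop m' (classes p w)"
proof (rule nth_equalityI)
  fix i assume i: "i < length (classes p (take m w @ drop m' w))"
  show "classes p (take m w @ drop m' w) ! i = (take m (classes p w) @ drop m' (classes p w)) ! i"
  proof (cases "i < m")
    case True
    then show ?thesis using i assms(1,2) by (simp add: nth_append)
  next
    case False
    then have "Suc i = m + Suc (i - m)" by simp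
    then have "Suc i mod p = (m' + Suc (i - m)) mod p" using assms(3) by (metis mod_add_left_eq)
    then show ?thesis using False i assms(1,2) by (simp add: nth_append)
  qed
qed (use assms in simp)

lemma foldl_in:
  assumes "\<And>s c. \<delta> s c \<in> insert s V" "a \<in> V"
  shows "foldl \<delta> a cs \<in> V"
  using assms(2)
proof (induction cs arbitrary: a)
  case (Cons c cs)
  have "\<delta> a c \<in> V" using assms(1)[of a c] Cons.prems by auto
  then show ?case by (simp add: Cons.IH)
qed simp

text \<open>An upper bound for the binary logarithm of the number of profiles of prefixes, with
  every parameter replaced by the complexity \<open>c\<close>: \<open>c\<close> for the length
  modulo the period, \<open>c ^ 2\<close> for the subset of classes, and \<open>c + 1\<close> bits
  for each fold. The last product counts the folds as layers times classes times heads times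
  (dimension + 1).\<close>

definition word_bound :: "nat \<Rightarrow> nat" where
  "word_bound c = c + c ^ 2 + (c + 1) * (c * (c ^ 2 * (c * (c + 1))))"

section \<open>Short words and rational outputs for a fixed encoder\<close>

context
  fixes T :: fix_te
  assumes T: "T \<in> T_fix"
begin

lemma fixed_width_arith: "fixed_width (arith T)"
  using T by (simp add: T_fix_def)

lemma rd_Rats: "x \<in> nums (arith T) \<Longrightarrow> x \<in> \<rat>"
  using fixed_width_arith by (auto simp: fixed_width_def)

lemma period_pos: "0 < period T"
  using T by (auto simp: T_fix_def additive_periodical_def)

lemma embedding:
  "\<exists>g. \<forall>w. set w \<subseteq> {..<alph_size T} \<longrightarrow>
    map2 (emb T) w [1..<Suc (length w)] = map g (classes (period T) w)"
proof -
  obtain emb' pos where pos: "\<forall>i. pos i = pos (i + period T)"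
    and emb: "\<forall>a<alph_size T. \<forall>i. emb T a i = fadd (rd (arith T)) (emb' a) (pos i)"
    using T unfolding T_fix_def additive_periodical_def by blast
  have per: "pos (i + k * period T) = pos i" for i k
  proof (induction k)
    case (Suc k)
    then show ?case using pos[rule_format, of "i + k * period T"] by (simp add: algebra_simps)
  qed simp
  have "pos (i mod period T) = pos i" for i
    using per[of "i mod period T" "i div period T"] by (simp add: mult.commute)
  then have emb: "emb T a i = fadd (rd (arith T)) (emb' a) (pos (i mod period T))" if "a < alph_size T" for a i
    using emb that by simp
  have "map2 (emb T) w [1..<Suc (length w)] =
      map (\<lambda>(a, r). fadd (rd (arith T)) (emb' a) (pos r)) (classes (period T) w)"
    if "set w \<subseteq> {..<alph_size T}" for w
  proof (rule nth_equalityI)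
    fix i assume "i < length (map2 (emb T) w [1..<Suc (length w)])"
    then have i: "i < length w" by (simp del: upt_Suc)
    then have "w ! i < alph_size T" using that nth_mem by fastforce
    then show "map2 (emb T) w [1..<Suc (length w)] ! i =
        map (\<lambda>(a, r). fadd (rd (arith T)) (emb' a) (pos r)) (classes (period T) w) ! i"
      using i by (simp add: emb del: upt_Suc)
  qed (simp del: upt_Suc)
  then show ?thesis by blast
qed

lemma emb_in:
  assumes "a < alph_size T"
  shows "emb T a i \<in> vecs (arith T) (dim0 T)"
proof -
  obtain emb' pos where "\<forall>a<alph_size T. emb' a \<in> vecs (arith T) (dim0 T)" "\<forall>i. pos i \<in> vecs (arith T) (dim0 T)"
    and "\<forall>a<alph_size T. \<forall>i. emb T a i = fadd (rd (arith T)) (emb' a) (pos i)"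
    using T unfolding T_fix_def additive_periodical_def by blast
  then show ?thesis using assms rd_in[OF fixed_width_arith] by (auto simp: vecs_def fadd_def)
qed

lemma head_bounds:
  assumes "l \<in> set (layers T)"
  shows "length (heads l) \<le> max_heads T"
    and "h \<in> set (heads l) \<Longrightarrow> length (weight h) \<le> max_dim T"
    and "h \<in> set (heads l) \<Longrightarrow> normalisation h \<in> {softmax (rd (arith T)), hardmax (rd (arith T))}"
proof -
  show "length (heads l) \<le> max_heads T"
    unfolding max_heads_def using assms by (intro Max_ge) auto
  have "{length (weight h) |l h. l \<in> set (layers T) \<and> h \<in> set (heads l)} =
      (\<Union>l\<in>set (layers T). (\<lambda>h. length (weight h)) ` set (heads l))" by blast
  then have "finite {length (weight h) |l h. l \<in> set (layers T) \<and> h \<in> set (heads l)}" by simp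
  then show "length (weight h) \<le> max_dim T" if "h \<in> set (heads l)"
    unfolding max_dim_def using assms that by (intro Max_ge) auto
  obtain i where "i < length (layers T)" "layers T ! i = l"
    using assms by (auto simp: in_set_conv_nth)
  then have "fix_layer (arith T) (dims T ! i) l" using T by (auto simp: T_fix_def)
  then show "normalisation h \<in> {softmax (rd (arith T)), hardmax (rd (arith T))}" if "h \<in> set (heads l)"
    using that by (simp add: fix_layer_def fix_head_def)
qed

lemma shorten_word:
  assumes w: "w \<in> words T" and long: "2 ^ word_bound (complexity T) < length w"
  obtains w' where "w' \<in> words T" "length w' < length w" "fix_eval T w' = fix_eval T w"
proof -
  obtain g where g: "\<And>w. set w \<subseteq> {..<alph_size T} \<Longrightarrow>
    map2 (emb T) w [1..<Suc (length w)] = map g (classes (period T) w)" using embedding by blast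
  have letters: "set w \<subseteq> {..<alph_size T}" using w by (simp add: words_def)
  define cs where "cs = classes (period T) w"
  define C where "C = {..<alph_size T} \<times> {..<period T}"
  have C: "set cs \<subseteq> C"
  proof
    fix c assume "c \<in> set cs"
    then obtain i where "i < length w" "c = (w ! i, Suc i mod period T)"
      by (auto simp: cs_def in_set_conv_nth)
    moreover from this have "w ! i \<in> {..<alph_size T}" using letters nth_mem by blast
    ultimately show "c \<in> C" using period_pos by (simp add: C_def)
  qed
  have "\<exists>g'. fold_determined (rd (arith T)) cs
      (length (layers T) * (card (set cs) * (max_heads T * Suc (max_dim T))))
      (\<lambda>cs'. foldl (\<lambda>xs l. apply_layer (rd (arith T)) l xs) (map g cs') (layers T) = map g' cs')"
    by (rule fold_determined_layers) (rule head_bounds; assumption)+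
  then obtain g' where "fold_determined (rd (arith T)) cs
      (length (layers T) * (card (set cs) * (max_heads T * Suc (max_dim T))))
      (\<lambda>cs'. foldl (\<lambda>xs l. apply_layer (rd (arith T)) l xs) (map g cs') (layers T) = map g' cs')"
    by (elim exE)
  then obtain \<Phi> where \<Phi>: "finite \<Phi>"
    and card: "card \<Phi> \<le> length (layers T) * (card (set cs) * (max_heads T * Suc (max_dim T)))"
    and \<delta>: "\<forall>\<delta>\<in>\<Phi>. \<forall>s c. \<delta> s c \<in> insert s (range (rd (arith T)))"
    and g': "\<forall>cs'. set cs' = set cs \<longrightarrow> (\<forall>\<delta>\<in>\<Phi>. foldl \<delta> 0 cs' = foldl \<delta> 0 cs) \<longrightarrow>
       foldl (\<lambda>xs l. apply_layer (rd (arith T)) l xs) (map g cs') (layers T) = map g' cs'"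
    unfolding fold_determined_def by (elim exE conjE)
  define V where "V = insert 0 (nums (arith T))"
  have V: "foldl \<delta> 0 cs' \<in> V" if "\<delta> \<in> \<Phi>" for \<delta> cs'
  proof (rule foldl_in)
    show "\<delta> s c \<in> insert s V" for s c
      using \<delta>[rule_format, OF that, of s c] rd_in[OF fixed_width_arith] by (auto simp: V_def)
  qed (simp add: V_def)
  \<comment> \<open>The restriction to \<open>\<Phi>\<close> makes the family of fold values an
    element of the finite set \<open>\<Phi> \<rightarrow>\<^sub>E V\<close>.\<close>
  define profile where
    "profile m = (m mod period T, set (take m cs), \<lambda>\<delta>\<in>\<Phi>. foldl \<delta> 0 (take m cs))" for m
  define B where "B = {..<period T} \<times> Pow C \<times> (\<Phi> \<rightarrow>\<^sub>E V)"
  have finC: "finite C" and finV: "finite V"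
    using fixed_width_arith by (auto simp: C_def V_def fixed_width_def)
  then have finB: "finite B" using \<Phi> by (auto simp: B_def intro!: finite_PiE)
  \<comment> \<open>Only prefixes shorter than \<open>w\<close> compete. The suffix kept by the cut
    is then nonempty, so the last position, where the output is read, survives and \<open>w'\<close>
    is nonempty even if \<open>m = 0\<close>.\<close>
  have sub: "profile ` {..<length w} \<subseteq> B"
  proof (intro image_subsetI)
    fix m
    have "set (take m cs) \<subseteq> C" using C set_take_subset[of m cs] by blast
    then show "profile m \<in> B" using period_pos V by (simp add: profile_def B_def)
  qed
  have "card B \<le> 2 ^ word_bound (complexity T)"
  proof -
    let ?c = "complexity T"
    have le: "period T \<le> ?c" "alph_size T \<le> ?c" "length (layers T) \<le> ?c" "max_heads T \<le> ?c"
      "Suc (max_dim T) \<le> ?c + 1" "Suc (bits (arith T)) \<le> ?c + 1" by (simp_all add: complexity_def)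
    have cC: "card C \<le> ?c ^ 2"
      using le by (simp add: C_def power2_eq_square mult_le_mono)
    have "card \<Phi> \<le> length (layers T) * (card C * (max_heads T * Suc (max_dim T)))"
      using card_mono[OF finC C] by (intro order.trans[OF card] mult_le_mono) auto
    also have "\<dots> \<le> ?c * (?c ^ 2 * (?c * (?c + 1)))"
      using le cC by (intro mult_le_mono)
    finally have c\<Phi>: "card \<Phi> \<le> ?c * (?c ^ 2 * (?c * (?c + 1)))" .
    have "card V \<le> Suc (card (nums (arith T)))"
      using fixed_width_arith by (simp add: V_def card_insert_if fixed_width_def)
    also have "\<dots> \<le> Suc (2 ^ bits (arith T))" using fixed_width_arith by (simp add: fixed_width_def)
    also have "\<dots> \<le> 2 ^ Suc (bits (arith T))" by simp
    finally have cV: "card V \<le> 2 ^ Suc (bits (arith T))" .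
    have "card B = period T * (2 ^ card C * card V ^ card \<Phi>)"
      using finC \<Phi> by (simp add: B_def card_cartesian_product card_Pow card_PiE)
    \<comment> \<open>The crude \<open>period T \<le> 2 ^ period T\<close> brings all factors to
      base 2. The extra bit in \<open>Suc (bits (arith T))\<close> pays for the initial value 0 in
      \<open>V\<close>.\<close>
    also have "\<dots> \<le> 2 ^ (period T) * (2 ^ card C * (2 ^ Suc (bits (arith T))) ^ card \<Phi>)"
      using cV by (intro mult_le_mono power_mono) simp_all
    also have "\<dots> = 2 ^ (period T + card C + Suc (bits (arith T)) * card \<Phi>)"
      by (simp add: power_add power_mult)
    also have "\<dots> \<le> 2 ^ word_bound ?c"
      unfolding word_bound_def
      by (rule power_increasing)
        (use le cC c\<Phi> in \<open>auto intro!: add_le_mono mult_le_mono\<close>)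
    finally show ?thesis .
  qed
  then have "card (profile ` {..<length w}) < card {..<length w}"
    using card_mono[OF finB sub] long by simp
  then have "\<not> inj_on profile {..<length w}" by (rule pigeonhole)
  then have "\<exists>m m'. m < m' \<and> m' < length w \<and> profile m = profile m'"
    unfolding inj_on_def by (metis lessThan_iff linorder_neqE_nat)
  then obtain m m' where m: "m < m'" "m' < length w" and eq: "profile m = profile m'"
    by (elim exE conjE)
  define w' where "w' = take m w @ drop m' w"
  define cs' where "cs' = take m cs @ drop m' cs"
  have cs': "classes (period T) w' = cs'"
    using classes_cut[of m m' w "period T"] m eq by (simp add: w'_def cs'_def cs_def profile_def)
  have "set cs' = set (take m' cs) \<union> set (drop m' cs)"
    using eq by (simp add: cs'_def profile_def)
  also have "\<dots> = set cs" by (simp flip: set_append)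
  finally have set: "set cs' = set cs" .
  have fold: "foldl \<delta> 0 cs' = foldl \<delta> 0 cs" if "\<delta> \<in> \<Phi>" for \<delta>
  proof -
    have "(\<lambda>\<delta>\<in>\<Phi>. foldl \<delta> 0 (take m cs)) = (\<lambda>\<delta>\<in>\<Phi>. foldl \<delta> 0 (take m' cs))"
      using eq by (simp add: profile_def)
    from fun_cong[OF this, of \<delta>] have "foldl \<delta> 0 (take m cs) = foldl \<delta> 0 (take m' cs)"
      using that by simp
    then have "foldl \<delta> 0 cs' = foldl \<delta> 0 (take m' cs @ drop m' cs)" by (simp add: cs'_def del: append_take_drop_id)
    then show ?thesis by simp
  qed
  \<comment> \<open>Both \<open>w\<close> and \<open>w'\<close> are instances of \<open>v\<close>,
    so their outputs are given by the same \<open>g'\<close> and differ at most through the last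
    class.\<close>
  have ev: "fix_eval T v = out T (g' (last (classes (period T) v)))"
    if "set v \<subseteq> {..<alph_size T}" "v \<noteq> []" "set (classes (period T) v) = set cs"
      "\<And>\<delta>. \<delta> \<in> \<Phi> \<Longrightarrow> foldl \<delta> 0 (classes (period T) v) = foldl \<delta> 0 cs" for v
  proof -
    have "classes (period T) v \<noteq> []" using that(2) length_classes[of "period T" v] by (metis length_0_conv)
    moreover have "foldl (\<lambda>xs l. apply_layer (rd (arith T)) l xs) (map g (classes (period T) v)) (layers T) =
        map g' (classes (period T) v)"
      using g' that(3,4) by blast
    ultimately show ?thesis
      unfolding fix_eval_def te_eval_def g[OF that(1)] by (simp add: last_map)
  qed
  have lets: "set w' \<subseteq> {..<alph_size T}" and "w' \<noteq> []"
    using letters m set_take_subset[of m w] set_drop_subset[of m' w] by (auto simp: w'_def)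
  moreover have "fix_eval T w' = fix_eval T w"
  proof -
    have "last cs' = last cs" using m by (simp add: cs'_def cs_def last_append)
    then show ?thesis
      using ev[OF lets \<open>w' \<noteq> []\<close>] ev[OF letters] w set fold cs'
      by (simp add: cs_def words_def)
  qed
  moreover have "length w' < length w" using m by (simp add: w'_def)
  ultimately show ?thesis using that by (simp add: words_def)
qed

lemma small_word:
  assumes "satisfiable T"
  obtains w where "w \<in> words T" "fix_eval T w = 1" "length w \<le> 2 ^ word_bound (complexity T)"
proof -
  have "\<exists>w. w \<in> words T \<and> fix_eval T w = 1"
    using assms by (auto simp: satisfiable_def)
  then obtain w where w: "w \<in> words T" "fix_eval T w = 1"
    and min: "\<And>v. v \<in> words T \<Longrightarrow> fix_eval T v = 1 \<Longrightarrow> length w \<le> length v"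
    using ex_has_least_nat[of "\<lambda>w. w \<in> words T \<and> fix_eval T w = 1" _ length] by metis
  have "length w \<le> 2 ^ word_bound (complexity T)"
    using shorten_word[OF w(1)] min w(2) by (metis not_le)
  then show ?thesis using that w by blast
qed

section \<open>Representability of all computed vectors\<close>

lemma fsum_in: "xs \<noteq> [] \<Longrightarrow> fsum (rd (arith T)) xs \<in> nums (arith T)"
  using rd_in[OF fixed_width_arith] by (cases xs rule: rev_cases) (simp_all add: fsum_def)

lemma apply_layer_in:
  assumes l: "fix_layer (arith T) d l" and xs: "xs \<noteq> []" "set xs \<subseteq> vecs (arith T) d"
  shows "apply_layer (rd (arith T)) l xs \<noteq> [] \<and> set (apply_layer (rd (arith T)) l xs) \<subseteq> vecs (arith T) (out_dim l)"
proof -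
  \<comment> \<open>Every entry is a sum over the nonempty list \<open>xs\<close>, so its last
    operation is a rounding. An empty sum would be 0, which need not be representable.\<close>
  have "pool (rd (arith T)) h xs ss \<in> vecs (arith T) (length (weight h))" for h ss
    using xs(1) by (auto simp: vecs_def pool_def intro!: fsum_in)
  then have "list_all2 (\<lambda>h y. y \<in> vecs (arith T) (length (weight h))) (heads l)
      (map (\<lambda>h. pool (rd (arith T)) h xs (map (score h x) xs)) (heads l))" for x
    by (simp add: list_all2_conv_all_nth)
  then have "comb l x (map (\<lambda>h. pool (rd (arith T)) h xs (map (score h x) xs)) (heads l)) \<in>
      vecs (arith T) (out_dim l)" if "x \<in> set xs" for x
    using l xs(2) that unfolding fix_layer_def by blast
  then show ?thesis using xs(1) by (auto simp: apply_layer_def)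
qed

lemma layers_in:
  assumes "\<forall>i<length ls. fix_layer (arith T) ((d # map out_dim ls) ! i) (ls ! i)"
    and "xs \<noteq> []" "set xs \<subseteq> vecs (arith T) d"
  shows "foldl (\<lambda>xs l. apply_layer (rd (arith T)) l xs) xs ls \<noteq> [] \<and>
    set (foldl (\<lambda>xs l. apply_layer (rd (arith T)) l xs) xs ls) \<subseteq> vecs (arith T) (last (d # map out_dim ls))"
  using assms
proof (induction ls arbitrary: d xs)
  case (Cons l ls)
  have "fix_layer (arith T) d l" using Cons.prems(1) by auto
  note l = apply_layer_in[OF this Cons.prems(2,3)]
  have "\<forall>i<length ls. fix_layer (arith T) ((out_dim l # map out_dim ls) ! i) (ls ! i)"
    using Cons.prems(1) by (metis Suc_less_eq length_Cons list.simps(9) nth_Cons_Suc)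
  from Cons.IH[OF this l[THEN conjunct1] l[THEN conjunct2]] show ?case by simp
qed simp

text \<open>Needed to recover the output from its code: \<open>num\<close> is injective on the
  rationals only.\<close>

lemma fix_eval_Rats:
  assumes w: "w \<in> words T"
  shows "fix_eval T w \<in> \<rat>"
proof -
  let ?xs = "map2 (emb T) w [1..<Suc (length w)]"
  have "set ?xs \<subseteq> vecs (arith T) (dim0 T)"
  proof
    fix x assume "x \<in> set ?xs"
    then obtain a i where "a \<in> set w" and x: "x = emb T a i"
      by (auto dest: set_zip_leftD simp del: upt_Suc)
    then have "a < alph_size T" using w by (auto simp: words_def)
    then show "x \<in> vecs (arith T) (dim0 T)" unfolding x by (rule emb_in)
  qed
  moreover have "?xs \<noteq> []"
  proof -
    have "length ?xs \<noteq> 0" using w by (simp add: words_def del: upt_Suc)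
    then show ?thesis by force
  qed
  moreover have "\<forall>i<length (layers T). fix_layer (arith T) (dims T ! i) (layers T ! i)"
    using T by (simp add: T_fix_def)
  ultimately have "last (foldl (\<lambda>xs l. apply_layer (rd (arith T)) l xs) ?xs (layers T)) \<in>
      vecs (arith T) (last (dims T))"
    using layers_in[of "layers T" "dim0 T" ?xs] last_in_set unfolding dims_def by blast
  then have "fix_eval T w \<in> nums (arith T)"
    using T by (simp add: fix_eval_def te_eval_def T_fix_def)
  then show ?thesis by (rule rd_Rats)
qed

end

subsection \<open>The guessing machine\<close>

text \<open>Keeps the evaluator's polynomial time exponential on words of exponential length. In
  Horner form, a multiplication by \<open>m\<close> adds \<open>e\<close> to the exponent, and a
  coefficient \<open>c\<close> adds \<open>c\<close> because
  \<open>c + 1 \<le> 2 ^ c\<close>.\<close>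

lemma poly_le_two_power:
  fixes p :: "nat poly"
  shows "\<exists>a d. \<forall>m e. m \<le> 2 ^ e \<longrightarrow> poly p m \<le> 2 ^ (a + d * e)"
proof (induction p)
  case (pCons c p)
  then obtain a d where IH: "\<And>m e. m \<le> 2 ^ e \<Longrightarrow> poly p m \<le> 2 ^ (a + d * e)" by blast
  have "poly (pCons c p) m \<le> 2 ^ ((c + a) + Suc d * e)" if m: "m \<le> 2 ^ e" for m e
  proof -
    have "m * poly p m \<le> 2 ^ e * 2 ^ (a + d * e)" by (intro mult_le_mono m IH)
    then have "poly (pCons c p) m \<le> c * 1 + 2 ^ (e + (a + d * e))" by (simp add: power_add)
    also have "\<dots> \<le> c * 2 ^ (e + (a + d * e)) + 2 ^ (e + (a + d * e))"
      by (intro add_le_mono mult_le_mono) simp_all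
    also have "\<dots> = Suc c * 2 ^ (e + (a + d * e))" by simp
    also have "\<dots> \<le> 2 ^ c * 2 ^ (e + (a + d * e))"
      by (intro mult_le_mono) (simp_all add: Suc_le_eq less_exp)
    also have "\<dots> = 2 ^ ((c + a) + Suc d * e)" by (simp flip: power_add add: algebra_simps)
    finally show ?thesis .
  qed
  then show ?case by blast
qed (auto)

lemma step_deterministic:
  assumes "deterministic M" "step M c d" "step M c d'"
  shows "d = d'"
proof -
  let ?rs = "map (\<lambda>(t, p). t p) (snd c)"
  obtain as where as: "(fst c, ?rs, fst d, as) \<in> trans M"
    "snd d = map2 (\<lambda>(t, p) (s, d). (t(p := s), p + d)) (snd c) as"
    using assms(2) by (auto simp: step_def)
  obtain as' where as': "(fst c, ?rs, fst d', as') \<in> trans M"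
    "snd d' = map2 (\<lambda>(t, p) (s, d). (t(p := s), p + d)) (snd c) as'"
    using assms(3) by (auto simp: step_def)
  have "(fst d, as) = (fst d', as')"
    using assms(1)[unfolded deterministic_def] as(1) as'(1) by blast
  then show ?thesis using as(2) as'(2) by (simp add: prod_eq_iff)
qed

text \<open>Identifies the halting configuration found on an accepting branch with the one that
  \<open>computes_within\<close> promises for the guessed word.\<close>

lemma halting_unique:
  assumes det: "deterministic M"
    and "(step M)\<^sup>*\<^sup>* c d" "\<nexists>e. step M d e" "(step M)\<^sup>*\<^sup>* c d'" "\<nexists>e. step M d' e"
  shows "d = d'"
  using assms(2-)
proof (induction rule: converse_rtranclp_induct)
  case base
  then show ?case by (blast elim: converse_rtranclpE)
next
  case (step c c1)
  from \<open>(step M)\<^sup>*\<^sup>* c d'\<close> show ?case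
  proof (cases rule: converse_rtranclpE)
    case base
    then show ?thesis using step by blast
  next
    case (step c2)
    then have "c2 = c1" using step_deterministic[OF det] \<open>step M c c1\<close> by blast
    then show ?thesis using step(2) \<open>\<nexists>e. step M d' e\<close> \<open>\<nexists>e. step M d e\<close>
      \<open>\<lbrakk>\<nexists>e. step M d e; (step M)\<^sup>*\<^sup>* c1 d'; \<nexists>e. step M d' e\<rbrakk> \<Longrightarrow> d = d'\<close> by blast
  qed
qed

section \<open>Strings on tapes\<close>

lemma tape_of_start: "(fst (tape_of xs), 0) = tape_of xs"
  by (simp add: tape_of_def)

lemma tape_of_nth: "i < length xs \<Longrightarrow> fst (tape_of xs) (int i) = (if xs ! i then 2 else 1)"
  by (simp add: tape_of_def)

lemma tape_of_end: "length xs \<le> i \<Longrightarrow> fst (tape_of xs) (int i) = 0"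
  by (simp add: tape_of_def)

lemma tape_of_neg: "i < 0 \<Longrightarrow> fst (tape_of xs) i = 0"
  by (simp add: tape_of_def)

lemma tape_of_snoc:
  "(fst (tape_of xs))(int (length xs) := if b then 2 else 1) = fst (tape_of (xs @ [b]))"
  by (auto simp: tape_of_def fun_eq_iff nth_append)

lemma tape_of_eqI:
  assumes "\<And>i. i \<le> length v \<Longrightarrow> fst (tape_of xs) (int i) = fst (tape_of v) (int i)"
  shows "xs = v"
proof (rule nth_equalityI)
  show len: "length xs = length v"
  proof (rule linorder_cases)
    assume "length xs < length v"
    then show ?thesis using assms[of "length xs"] by (auto simp: tape_of_def split: if_splits)
  next
    assume "length v < length xs"
    then show ?thesis using assms[of "length v"] by (auto simp: tape_of_def split: if_splits)
  qed
  show "xs ! i = v ! i" if "i < length xs" for i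
    using assms[of i] that len by (auto simp: tape_of_def split: if_splits)
qed

text \<open>These are the cells the input head can visit while guessing: a blank as left end marker,
  one 2 per letter of the alphabet, and the terminator 1.\<close>

lemma tape_of_unary:
  assumes "- 1 \<le> j" "j \<le> int n"
  shows "fst (tape_of (unary n @ r)) j = (if j = - 1 then 0 else if j < int n then 2 else 1)"
  using assms by (auto simp: tape_of_def unary_def nth_append)

lemma act_stay:
  fixes ts :: "tape list"
  shows "map2 (\<lambda>(t, p) (s, d). (t(p := s), p + d)) ts (map (\<lambda>s. (s, 0)) (map (\<lambda>(t, p). t p) ts)) = ts"
  by (rule nth_equalityI) (auto split: prod.splits)

lemma act_move_right:
  fixes ts :: "tape list"
  assumes "k < length ts"
  shows "map2 (\<lambda>(t, p) (s, d). (t(p := s), p + d)) ts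
      ((map (\<lambda>s. (s, 0)) (map (\<lambda>(t, p). t p) ts))[k := (map (\<lambda>(t, p). t p) ts ! k, 1)]) =
    ts[k := (fst (ts ! k), snd (ts ! k) + 1 :: int)]"
  by (rule nth_equalityI) (use assms in \<open>auto simp: nth_list_update split: prod.splits\<close>)

text \<open>Machine states are natural numbers; \<open>to_nat\<close> of this countable type
  supplies disjoint copies for the phases. \<open>Sim\<close> carries a state of the evaluator,
  \<open>Check\<close> the number of output cells matched so far.\<close>

datatype control = Guess | Back | Rewind | Sim nat | Check nat

instance control :: countable by countable_datatype

text \<open>Halting is the absence of a transition. To list all halting situations by finitely many
  rules, the symbols, states and readings that can occur in a run are enclosed in finite
  sets.\<close>

definition symbols :: "tm \<Rightarrow> nat set" where
  "symbols M = {0, 1, 2} \<union> (\<Union>(q, rs, q', as)\<in>trans M. fst ` set as)"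

definition states :: "tm \<Rightarrow> nat set" where
  "states M = insert (start M) ((\<lambda>(q, rs, q', as). q') ` trans M)"

definition readings :: "tm \<Rightarrow> nat list set" where
  "readings M = {rs. set rs \<subseteq> symbols M \<and> length rs = tapes M}"

definition guess_rule ::
  "tm \<Rightarrow> control \<Rightarrow> nat \<Rightarrow> nat \<Rightarrow> control \<Rightarrow> int \<Rightarrow> nat \<Rightarrow> int \<Rightarrow> nat \<times> nat list \<times> nat \<times> (nat \<times> int) list"
  where "guess_rule M q a b q' da b' db =
    (to_nat q, a # b # replicate (tapes M - 2) 0,
     to_nat q', (a, da) # (b', db) # replicate (tapes M - 2) (0, 0))"

text \<open>
  The input starts with the size of the alphabet in unary.  While a letter is written in unary to the
  second tape, the head of the first tape moves along that prefix, so only letters of the alphabet can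
  be written.
\<close>

definition guess_rules :: "tm \<Rightarrow> (nat \<times> nat list \<times> nat \<times> (nat \<times> int) list) set" where
  "guess_rules M =
     {guess_rule M Guess 2 0 Guess 1 2 1,
      guess_rule M Guess 2 0 Back (- 1) 1 1,
      guess_rule M Back 2 0 Back (- 1) 0 0,
      guess_rule M Back 0 0 Guess 1 0 0,
      guess_rule M Back 0 0 Rewind 1 0 (- 1),
      guess_rule M Rewind 2 1 Rewind 0 1 (- 1),
      guess_rule M Rewind 2 2 Rewind 0 2 (- 1),
      guess_rule M Rewind 2 0 (Sim (start M)) 0 0 1}"

definition sim_rules :: "tm \<Rightarrow> (nat \<times> nat list \<times> nat \<times> (nat \<times> int) list) set" where
  "sim_rules M = (\<lambda>(q, rs, q', as). (to_nat (Sim q), rs, to_nat (Sim q'), as)) ` trans M"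

text \<open>The evaluator announces its result by getting stuck, which has to become a step into the
  comparison phase.\<close>

definition halt_rules :: "tm \<Rightarrow> (nat \<times> nat list \<times> nat \<times> (nat \<times> int) list) set" where
  "halt_rules M =
     (\<lambda>(q, rs). (to_nat (Sim q), rs, to_nat (Check 0), map (\<lambda>s. (s, 0)) rs)) `
     {(q, rs) \<in> states M \<times> readings M. \<nexists>q' as. (q, rs, q', as) \<in> trans M}"

text \<open>Tape 2 is the output tape behind the two inputs. The index \<open>length v\<close> is
  included: there the blank after \<open>v\<close> must be read, which excludes proper extensions of
  \<open>v\<close>. The accepting state is therefore \<open>Check (Suc (length v))\<close>.\<close>

definition check_rules :: "tm \<Rightarrow> bool list \<Rightarrow> (nat \<times> nat list \<times> nat \<times> (nat \<times> int) list) set" where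
  "check_rules M v =
     (\<lambda>(i, rs). (to_nat (Check i), rs, to_nat (Check (Suc i)),
        (map (\<lambda>s. (s, 0)) rs)[2 := (rs ! 2, 1)])) `
     {(i, rs) \<in> {..length v} \<times> readings M. rs ! 2 = fst (tape_of v) (int i)}"

definition guesser :: "tm \<Rightarrow> bool list \<Rightarrow> tm" where
  "guesser M v = \<lparr>tapes = tapes M, start = to_nat Guess, accept = to_nat (Check (Suc (length v))),
     trans = guess_rules M \<union> sim_rules M \<union> halt_rules M \<union> check_rules M v\<rparr>"

lemma guesser_sel [simp]:
  "tapes (guesser M v) = tapes M" "start (guesser M v) = to_nat Guess"
  "accept (guesser M v) = to_nat (Check (Suc (length v)))"
  by (simp_all add: guesser_def)

text \<open>\<open>n\<close> and \<open>r\<close> describe one input, the size of the alphabet and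
  the remainder of the instance code. The machine depends only on \<open>M\<close> and
  \<open>v\<close>, so a single one serves all inputs. Three tapes are two inputs and the
  output.\<close>

locale guess_and_check =
  fixes M :: tm and v :: "bool list" and n :: nat and r :: "bool list"
  assumes wf: "wf_tm M" and tapes: "3 \<le> tapes M"
begin

abbreviation "N \<equiv> guesser M v"
abbreviation "input \<equiv> unary n @ r"
abbreviation "sim_input w \<equiv> init_config M [input, word_code w]"

definition conf :: "control \<Rightarrow> int \<Rightarrow> bool list \<Rightarrow> int \<Rightarrow> config" where
  "conf q j xs i = (to_nat q, (fst (tape_of input), j) # (fst (tape_of xs), i) #
     replicate (tapes M - 2) (tape_of []))"

definition sim :: "config \<Rightarrow> config" where
  "sim c = (to_nat (Sim (fst c)), snd c)"

definition check :: "nat \<Rightarrow> config \<Rightarrow> config" where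
  "check i c = (to_nat (Check i), (snd c)[2 := (fst (snd c ! 2), snd (snd c ! 2) + int i)])"

lemma finite_readings: "finite (readings M)"
proof -
  have "finite (symbols M)" using wf by (auto simp: symbols_def wf_tm_def)
  then show ?thesis unfolding readings_def by (rule finite_lists_length_eq)
qed

lemma wf_rule:
  assumes "(q, rs, q', as) \<in> trans M"
  shows "length rs = tapes M \<and> length as = tapes M \<and> snd ` set as \<subseteq> {- 1, 0, 1}"
proof -
  have "\<forall>(q, rs, q', as)\<in>trans M.
      length rs = tapes M \<and> length as = tapes M \<and> snd ` set as \<subseteq> {- 1, 0, 1}"
    using wf by (simp add: wf_tm_def)
  from bspec[OF this assms] show ?thesis by simp
qed

lemma wf_guesser: "wf_tm N"
proof -
  have "finite (states M)" using wf by (auto simp: states_def wf_tm_def)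
  then have "finite (states M \<times> readings M)" "finite ({..length v} \<times> readings M)"
    using finite_readings by auto
  then have fin: "finite (halt_rules M)" "finite (check_rules M v)"
    unfolding halt_rules_def check_rules_def by (auto intro!: finite_imageI elim: finite_subset[rotated])
  have move: "snd ` set ((map (\<lambda>s. (s, 0)) rs)[2 := (rs ! 2, 1)]) \<subseteq> {- 1, 0, 1 :: int}"
    for rs :: "nat list"
    using set_update_subset_insert[of "map (\<lambda>s. (s, 0 :: int)) rs" 2 "(rs ! 2, 1)"] by auto
  have ok: "length rs = tapes M \<and> length as = tapes M \<and> snd ` set as \<subseteq> {- 1, 0, 1}"
    if "(q, rs, q', as) \<in> trans N" for q rs q' as
    using that unfolding guesser_def tm.select_convs
  proof (elim UnE)
    assume "(q, rs, q', as) \<in> guess_rules M"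
    then show ?thesis using tapes by (auto simp: guess_rules_def guess_rule_def)
  next
    assume "(q, rs, q', as) \<in> sim_rules M"
    then obtain p p' where "(p, rs, p', as) \<in> trans M" by (auto simp: sim_rules_def)
    then show ?thesis by (rule wf_rule)
  next
    assume "(q, rs, q', as) \<in> halt_rules M"
    then show ?thesis by (auto simp: halt_rules_def readings_def)
  next
    assume "(q, rs, q', as) \<in> check_rules M v"
    then show ?thesis using move by (auto simp: check_rules_def readings_def)
  qed
  show ?thesis
    unfolding wf_tm_def guesser_sel
  proof (intro conjI ballI)
    show "finite (trans N)"
      using fin wf by (simp add: guesser_def guess_rules_def sim_rules_def wf_tm_def)
    fix x assume x: "x \<in> trans N"
    obtain q rs q' as where "x = (q, rs, q', as)" by (cases x)
    then show "case x of (q, rs, q', as) \<Rightarrow>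
        length rs = tapes M \<and> length as = tapes M \<and> snd ` set as \<subseteq> {- 1, 0, 1}"
      using ok x by simp
  qed (use tapes in simp)
qed

lemma upt_tapes: "[0..<tapes M] = 0 # 1 # [2..<tapes M]"
  using tapes by (simp add: upt_rec[of 0] upt_rec[of "Suc 0"] numeral_2_eq_2)

lemma init_guesser: "init_config N [input] = conf Guess 0 [] 0"
proof (rule prod_eqI)
  note upt_tapes
  moreover have "map (\<lambda>k. tape_of (if k < 1 then [input] ! k else [])) [2..<tapes M] =
      replicate (tapes M - 2) (tape_of [])" by (rule nth_equalityI) simp_all
  ultimately show "snd (init_config N [input]) = snd (conf Guess 0 [] 0)"
    by (simp add: init_config_def conf_def tape_of_start)
qed (simp add: init_config_def conf_def)

lemma init_sim: "conf (Sim (start M)) 0 (word_code w) 0 = sim (sim_input w)"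
proof (rule prod_eqI)
  note upt_tapes
  moreover have "map (\<lambda>k. tape_of (if k < Suc (Suc 0) then [input, word_code w] ! k else [])) [2..<tapes M] =
      replicate (tapes M - 2) (tape_of [])" by (rule nth_equalityI) simp_all
  ultimately show "snd (conf (Sim (start M)) 0 (word_code w) 0) = snd (sim (sim_input w))"
    by (simp add: init_config_def conf_def sim_def tape_of_start)
qed (simp add: init_config_def conf_def sim_def)

lemma guess_step:
  assumes "guess_rule M q a b q' da b' db \<in> guess_rules M"
    and "fst (tape_of input) j = a" "fst (tape_of xs) i = b"
    and "(fst (tape_of xs))(i := b') = fst (tape_of xs')"
    and "j' = j + da" "i' = i + db"
  shows "step N (conf q j xs i) (conf q' j' xs' i')"
proof -
  have "guess_rule M q a b q' da b' db \<in> trans N" using assms(1) by (simp add: guesser_def)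
  then show ?thesis
    unfolding step_def using assms(2-)
    by (intro exI[of _ "(a, da) # (b', db) # replicate (tapes M - 2) (0, 0)"])
      (auto simp: conf_def guess_rule_def tape_of_def zip_replicate)
qed

lemma guess_stepE:
  assumes "step N (conf q j xs i) c'" "q \<in> {Guess, Back, Rewind}"
  obtains a b q' da b' db where "guess_rule M q a b q' da b' db \<in> guess_rules M"
    and "fst (tape_of input) j = a" "fst (tape_of xs) i = b"
    and "\<And>xs'. (fst (tape_of xs))(i := b') = fst (tape_of xs') \<Longrightarrow> c' = conf q' (j + da) xs' (i + db)"
proof -
  obtain as where as: "(to_nat q, map (\<lambda>(t, p). t p) (snd (conf q j xs i)), fst c', as) \<in> trans N"
    and c': "snd c' = map2 (\<lambda>(t, p) (s, d). (t(p := s), p + d)) (snd (conf q j xs i)) as"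
    using assms(1) by (auto simp: step_def conf_def)
  have "(to_nat q, map (\<lambda>(t, p). t p) (snd (conf q j xs i)), fst c', as) \<in> guess_rules M"
    using as assms(2) by (auto simp: guesser_def sim_rules_def halt_rules_def check_rules_def)
  then obtain a b q' da b' db where rule: "guess_rule M q a b q' da b' db \<in> guess_rules M"
    and eq: "(to_nat q, map (\<lambda>(t, p). t p) (snd (conf q j xs i)), fst c', as) =
      guess_rule M q a b q' da b' db"
    unfolding guess_rules_def by (auto simp: guess_rule_def)
  have "c' = conf q' (j + da) xs' (i + db)" if "(fst (tape_of xs))(i := b') = fst (tape_of xs')" for xs'
    by (rule prod_eqI)
      (use eq that c' in \<open>auto simp: guess_rule_def conf_def tape_of_def zip_replicate\<close>)
  moreover have "fst (tape_of input) j = a" "fst (tape_of xs) i = b"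
    using eq by (auto simp: guess_rule_def conf_def)
  ultimately show ?thesis using that[OF rule] by blast
qed

lemma sim_step: "step M c d \<Longrightarrow> step N (sim c) (sim d)"
  unfolding step_def by (force simp: sim_def guesser_def sim_rules_def)

lemma sim_steps: "(step M ^^ k) c d \<Longrightarrow> (step N ^^ k) (sim c) (sim d)"
  by (induction k arbitrary: d) (auto intro: sim_step)

lemma sim_stepE:
  assumes "step N (sim c) c'"
  obtains d where "step M c d" "c' = sim d" | "\<nexists>d. step M c d" "c' = check 0 c"
proof -
  let ?rs = "map (\<lambda>(t, p). t p) (snd c)"
  obtain as where as: "(to_nat (Sim (fst c)), ?rs, fst c', as) \<in> trans N"
    and c': "snd c' = map2 (\<lambda>(t, p) (s, d). (t(p := s), p + d)) (snd c) as"
    using assms by (auto simp: step_def sim_def)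
  from as consider "(to_nat (Sim (fst c)), ?rs, fst c', as) \<in> sim_rules M"
    | "(to_nat (Sim (fst c)), ?rs, fst c', as) \<in> halt_rules M"
    by (auto simp: guesser_def guess_rules_def guess_rule_def check_rules_def)
  then show ?thesis
  proof cases
    case 1
    then obtain q' where q': "(fst c, ?rs, q', as) \<in> trans M" "fst c' = to_nat (Sim q')"
      by (auto simp: sim_rules_def)
    have "step M c (q', snd c')" using q'(1) c' by (auto simp: step_def)
    moreover have "c' = sim (q', snd c')" using q'(2) by (simp add: sim_def prod_eq_iff)
    ultimately show ?thesis by (rule that(1))
  next
    case 2
    then have no: "\<nexists>q' as. (fst c, ?rs, q', as) \<in> trans M" and fst: "fst c' = to_nat (Check 0)"
      and "as = map (\<lambda>s. (s, 0)) ?rs" by (auto simp: halt_rules_def)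
    then have "snd c' = snd c" unfolding c' by (simp only: act_stay)
    then have "c' = check 0 c" using fst by (simp add: check_def prod_eq_iff)
    moreover have "\<nexists>d. step M c d" using no by (auto simp: step_def)
    ultimately show ?thesis by (intro that(2))
  qed
qed

lemma check_rulesD:
  assumes "(to_nat (Check i), rs, q, as) \<in> check_rules M v"
  shows "length rs = tapes M" "i \<le> length v" "rs ! 2 = fst (tape_of v) (int i)"
    "q = to_nat (Check (Suc i))" "as = (map (\<lambda>s. (s, 0)) rs)[2 := (rs ! 2, 1)]"
  using assms by (auto simp: check_rules_def readings_def)

lemma check_stepE:
  assumes "step N (check i c) c'"
  shows "c' = check (Suc i) c \<and> i \<le> length v \<and>
    fst (snd c ! 2) (snd (snd c ! 2) + int i) = fst (tape_of v) (int i)"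
proof -
  let ?ts = "snd (check i c)"
  let ?rs = "map (\<lambda>(t, p). t p) ?ts"
  obtain as where as: "(to_nat (Check i), ?rs, fst c', as) \<in> trans N"
    and c': "snd c' = map2 (\<lambda>(t, p) (s, d). (t(p := s), p + d)) ?ts as"
    using assms by (auto simp: step_def check_def)
  have rule: "(to_nat (Check i), ?rs, fst c', as) \<in> check_rules M v"
    using as by (auto simp: guesser_def guess_rules_def guess_rule_def sim_rules_def halt_rules_def)
  have len: "length ?rs = tapes M" and i: "i \<le> length v"
    and rs: "?rs ! 2 = fst (tape_of v) (int i)" and fst: "fst c' = to_nat (Check (Suc i))"
    and as: "as = (map (\<lambda>s. (s, 0)) ?rs)[2 := (?rs ! 2, 1)]"
    by (rule check_rulesD[OF rule])+
  have 2: "2 < length (snd c)" "2 < length ?ts" using len tapes by (auto simp: check_def)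
  have "snd c' = ?ts[2 := (fst (?ts ! 2), snd (?ts ! 2) + 1)]"
    unfolding c' as by (rule act_move_right[OF 2(2)])
  then have "c' = check (Suc i) c"
    using fst 2(1) by (simp add: check_def prod_eq_iff ac_simps)
  moreover have "fst (snd c ! 2) (snd (snd c ! 2) + int i) = fst (tape_of v) (int i)"
    using rs 2(1) by (simp add: check_def)
  ultimately show ?thesis using i by blast
qed

section \<open>Soundness: an invariant of the guessing machine\<close>

definition good :: "nat list \<Rightarrow> bool" where
  "good w \<longleftrightarrow> w \<noteq> [] \<and> set w \<subseteq> {..<n}"

text \<open>One clause per phase. In \<open>Guess\<close> the input head position \<open>j\<close>
  equals the number of marks already written for the unfinished letter. \<open>Back\<close> is
  entered only after a completed letter, hence \<open>good w\<close>, which makes the guessed word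
  nonempty. \<open>Check\<close> remembers the halting configuration and the cells matched in
  it.\<close>

inductive guessed :: "config \<Rightarrow> bool" where
  Guess: "\<lbrakk>set w \<subseteq> {..<n}; j \<le> n; xs = word_code w @ replicate j True\<rbrakk>
    \<Longrightarrow> guessed (conf Guess (int j) xs (int (length xs)))"
| Back: "\<lbrakk>good w; - 1 \<le> j; j \<le> int n; i = int (length (word_code w))\<rbrakk>
    \<Longrightarrow> guessed (conf Back j (word_code w) i)"
| Rewind: "\<lbrakk>good w; - 1 \<le> i; i < int (length (word_code w))\<rbrakk>
    \<Longrightarrow> guessed (conf Rewind 0 (word_code w) i)"
| Sim: "\<lbrakk>good w; (step M)\<^sup>*\<^sup>* (sim_input w) d\<rbrakk> \<Longrightarrow> guessed (sim d)"
| Check: "\<lbrakk>good w; (step M)\<^sup>*\<^sup>* (sim_input w) d; \<nexists>e. step M d e;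
      \<And>i'. i' < i \<Longrightarrow> fst (snd d ! 2) (snd (snd d ! 2) + int i') = fst (tape_of v) (int i')\<rbrakk>
    \<Longrightarrow> guessed (check i d)"

lemma word_code_snoc: "word_code (w @ [a]) = word_code w @ replicate a True @ [False]"
  by (simp add: word_code_def unary_def)

lemma guessed_step:
  assumes "guessed c" "step N c c'"
  shows "guessed c'"
  using assms
proof (induction rule: guessed.cases)
  case (Guess w j xs)
  let ?i = "int (length xs)"
  obtain a b q' da b' db where rule: "guess_rule M Guess a b q' da b' db \<in> guess_rules M"
    and a: "fst (tape_of input) (int j) = a" and b: "fst (tape_of xs) ?i = b"
    and c': "\<And>xs'. (fst (tape_of xs))(?i := b') = fst (tape_of xs') \<Longrightarrow>
      c' = conf q' (int j + da) xs' (?i + db)"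
    by (rule guess_stepE[OF Guess(5)[unfolded Guess(1)]]) (simp, rule that)
  \<comment> \<open>Every rule in state \<open>Guess\<close> reads a 2 on the input tape. The
    terminator in cell \<open>n\<close> thus blocks it, and a letter finished here is below
    \<open>n\<close>.\<close>
  have "a = 2" using rule by (auto simp: guess_rules_def guess_rule_def)
  then have j: "j < n" using a Guess(3) tape_of_unary[of "int j" n r] by (auto split: if_splits)
  from rule consider "q' = Guess" "da = 1" "b' = 2" "db = 1" | "q' = Back" "da = - 1" "b' = 1" "db = 1"
    by (auto simp: guess_rules_def guess_rule_def)
  then show ?case
  proof cases
    case 1
    have "c' = conf Guess (int (Suc j)) (xs @ [True]) (int (length (xs @ [True])))"
      using c'[of "xs @ [True]"] tape_of_snoc[of xs True] 1 by (simp add: algebra_simps)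
    moreover have "xs @ [True] = word_code w @ replicate (Suc j) True"
      using Guess(4) by (simp add: replicate_append_same)
    ultimately show ?thesis using guessed.Guess[OF Guess(2), of "Suc j" "xs @ [True]"] j by simp
  next
    case 2
    have "c' = conf Back (int j - 1) (xs @ [False]) (int (length (xs @ [False])))"
      using c'[of "xs @ [False]"] tape_of_snoc[of xs False] 2 by (simp add: algebra_simps)
    moreover have "xs @ [False] = word_code (w @ [j])"
      using Guess(4) by (simp add: word_code_snoc)
    ultimately show ?thesis
      using guessed.Back[of "w @ [j]" "int j - 1"] Guess(2) j by (simp add: good_def)
  qed
next
  case (Back w j i)
  obtain a b q' da b' db where rule: "guess_rule M Back a b q' da b' db \<in> guess_rules M"
    and a: "fst (tape_of input) j = a" and b: "fst (tape_of (word_code w)) i = b"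
    and c': "\<And>xs'. (fst (tape_of (word_code w)))(i := b') = fst (tape_of xs') \<Longrightarrow>
      c' = conf q' (j + da) xs' (i + db)"
    by (rule guess_stepE[OF Back(6)[unfolded Back(1)]]) (simp, rule that)
  from rule consider "q' = Back" "da = - 1" "b' = 0" "b = 0" "db = 0" "a = 2"
    | "q' = Guess" "da = 1" "b' = 0" "b = 0" "db = 0" "a = 0"
    | "q' = Rewind" "da = 1" "b' = 0" "b = 0" "db = - 1" "a = 0"
    by (auto simp: guess_rules_def guess_rule_def)
  then show ?case
  proof cases
    case 1
    then have "j \<noteq> - 1" using a tape_of_neg[of j input] by auto
    then show ?thesis
      using c'[of "word_code w"] 1 b guessed.Back[of w "j - 1" i] Back
      by (simp add: fun_upd_idem)
  next
    case 2
    then have "j = - 1" using a tape_of_unary[of j n r] Back by (auto split: if_splits)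
    then show ?thesis
      using c'[of "word_code w"] 2 b guessed.Guess[of w 0 "word_code w"] Back
      by (simp add: fun_upd_idem good_def)
  next
    case 3
    then have "j = - 1" using a tape_of_unary[of j n r] Back by (auto split: if_splits)
    then show ?thesis
      using c'[of "word_code w"] 3 b guessed.Rewind[of w "i - 1"] Back
      by (simp add: fun_upd_idem)
  qed
next
  case (Rewind w i)
  obtain a b q' da b' db where rule: "guess_rule M Rewind a b q' da b' db \<in> guess_rules M"
    and b: "fst (tape_of (word_code w)) i = b"
    and c': "\<And>xs'. (fst (tape_of (word_code w)))(i := b') = fst (tape_of xs') \<Longrightarrow>
      c' = conf q' (0 + da) xs' (i + db)"
    by (rule guess_stepE[OF Rewind(5)[unfolded Rewind(1)]]) (simp, rule that)
  from rule consider "q' = Rewind" "da = 0" "b' = b" "b \<noteq> 0" "db = - 1"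
    | "q' = Sim (start M)" "da = 0" "b' = 0" "b = 0" "db = 1"
    by (auto simp: guess_rules_def guess_rule_def)
  then show ?case
  proof cases
    case 1
    then have "i \<noteq> - 1" using b tape_of_neg[of i "word_code w"] by auto
    then show ?thesis
      using c'[of "word_code w"] 1 b guessed.Rewind[of w "i - 1"] Rewind
      by (simp add: fun_upd_idem)
  next
    case 2
    \<comment> \<open>The cells of the written word hold 1 or 2, so within the range of the
      invariant a blank is found only to the left of the word.\<close>
    have "i = - 1"
    proof (rule ccontr)
      assume "i \<noteq> - 1"
      then obtain m where "i = int m" using Rewind(3) by (cases i rule: int_cases4) auto
      then show False using b 2 Rewind(4) tape_of_nth[of m "word_code w"] by (simp split: if_splits)
    qed
    then have "c' = sim (sim_input w)"
      using c'[of "word_code w"] 2 b init_sim by (simp add: fun_upd_idem)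
    then show ?thesis using guessed.Sim[OF Rewind(2)] by blast
  qed
next
  case (Sim w d)
  from Sim(4)[unfolded Sim(1)] show ?case
  proof (rule sim_stepE)
    fix e assume "step M d e" "c' = sim e"
    then show ?thesis
      using guessed.Sim[OF Sim(2) rtranclp.rtrancl_into_rtrancl[OF Sim(3)], of e] by simp
  next
    assume "\<nexists>e. step M d e" "c' = check 0 d"
    then show ?thesis using guessed.Check[OF Sim(2,3), of 0] by simp
  qed
next
  case (Check w d i)
  note step = check_stepE[OF Check(6)[unfolded Check(1)]]
  have "guessed (check (Suc i) d)"
  proof (rule guessed.Check[OF Check(2-4)])
    show "fst (snd d ! 2) (snd (snd d ! 2) + int i') = fst (tape_of v) (int i')" if "i' < Suc i" for i'
      using step Check(5) that by (cases "i' = i") simp_all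
  qed
  then show ?case using step by simp
qed

lemma guesser_sound:
  assumes "(step N)\<^sup>*\<^sup>* (init_config N [input]) c" "fst c = accept N"
  obtains w d where "good w" "(step M)\<^sup>*\<^sup>* (sim_input w) d" "\<nexists>e. step M d e"
    and "\<And>i. i \<le> length v \<Longrightarrow> fst (snd d ! 2) (snd (snd d ! 2) + int i) = fst (tape_of v) (int i)"
proof -
  have "guessed (init_config N [input])"
    using guessed.Guess[of "[]" 0 "[]"] by (simp add: init_guesser word_code_def)
  with assms(1) have "guessed c" by (induction) (auto intro: guessed_step)
  then show ?thesis
  proof cases
    case (Check w d i)
    then have "i = Suc (length v)" using assms(2) by (simp add: check_def)
    then show ?thesis using that[OF Check(2-4)] Check(5) by simp
  qed (use assms(2) in \<open>simp_all add: conf_def sim_def\<close>)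
qed

section \<open>Completeness: an accepting run with its length\<close>

lemma guess_letter:
  assumes "a < n"
  shows "(step N ^^ (2 * a + 1)) (conf Guess 0 (word_code w) (int (length (word_code w))))
    (conf Back (- 1) (word_code (w @ [a])) (int (length (word_code (w @ [a])))))"
proof -
  let ?l = "length (word_code w)"
  have up: "(step N ^^ j) (conf Guess 0 (word_code w) (int ?l))
      (conf Guess (int j) (word_code w @ replicate j True) (int (?l + j)))" if "j \<le> n" for j
    using that
  proof (induction j)
    case (Suc j)
    have "step N (conf Guess (int j) (word_code w @ replicate j True) (int (?l + j)))
        (conf Guess (int (Suc j)) (word_code w @ replicate (Suc j) True) (int (?l + Suc j)))"
      using tape_of_snoc[of "word_code w @ replicate j True" True]
        tape_of_end[of "word_code w @ replicate j True" "?l + j"]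
        tape_of_unary[of "int j" n r] Suc.prems
      by (intro guess_step[where q = Guess and a = 2 and b = 0 and b' = 2])
        (auto simp: guess_rules_def replicate_append_same)
    with Suc show ?case by (simp del: relpowp.simps add: relpowp_Suc_I)
  qed simp
  let ?xs = "word_code (w @ [a])"
  have turn: "step N (conf Guess (int a) (word_code w @ replicate a True) (int (?l + a)))
      (conf Back (int a - 1) ?xs (int (length ?xs)))"
    using tape_of_snoc[of "word_code w @ replicate a True" False]
      tape_of_end[of "word_code w @ replicate a True" "?l + a"]
      tape_of_unary[of "int a" n r] assms
    by (intro guess_step[where q = Guess and a = 2 and b = 0 and b' = 1])
      (auto simp: guess_rules_def word_code_snoc)
  have down: "(step N ^^ j) (conf Back (int j - 1) ?xs (int (length ?xs)))
      (conf Back (- 1) ?xs (int (length ?xs)))" if "j \<le> a" for j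
    using that
  proof (induction j)
    case (Suc j)
    have "step N (conf Back (int (Suc j) - 1) ?xs (int (length ?xs)))
        (conf Back (int j - 1) ?xs (int (length ?xs)))"
      using tape_of_end[of ?xs "length ?xs"] tape_of_unary[of "int j" n r] Suc.prems assms
      by (intro guess_step[where q = Back and a = 2 and b = 0 and b' = 0])
        (auto simp: guess_rules_def fun_upd_idem)
    with Suc show ?case by (meson Suc_leD relpowp_Suc_I2)
  qed simp
  \<comment> \<open>\<open>a\<close> steps write marks, one step writes the terminator and turns the
    input head back to \<open>a - 1\<close>, and \<open>a\<close> steps take it to the blank at
    -1.\<close>
  have "(step N ^^ (a + Suc a)) (conf Guess 0 (word_code w) (int ?l))
      (conf Back (- 1) ?xs (int (length ?xs)))"
    by (rule relpowp_trans[OF up relpowp_Suc_I2[OF turn down]]) (use assms in auto)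
  then show ?thesis by (simp add: mult_2)
qed

text \<open>A letter \<open>a\<close> costs \<open>2 * a + 1\<close> steps plus one step from
  \<open>Back\<close> to \<open>Guess\<close>, twice the length \<open>a + 1\<close> of its
  code.\<close>

lemma guess_prefix:
  assumes "set w \<subseteq> {..<n}"
  shows "(step N ^^ (2 * length (word_code w))) (conf Guess 0 [] 0)
    (conf Guess 0 (word_code w) (int (length (word_code w))))"
  using assms
proof (induction w rule: rev_induct)
  case Nil
  then show ?case by (simp add: word_code_def)
next
  case (snoc a w)
  let ?xs = "word_code (w @ [a])"
  have "step N (conf Back (- 1) ?xs (int (length ?xs))) (conf Guess 0 ?xs (int (length ?xs)))"
    using tape_of_end[of ?xs "length ?xs"] tape_of_neg[of "- 1" input]
    by (intro guess_step[where q = Back and a = 0 and b = 0 and b' = 0])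
      (auto simp: guess_rules_def fun_upd_idem)
  then have "(step N ^^ Suc (2 * length (word_code w) + (2 * a + 1))) (conf Guess 0 [] 0)
      (conf Guess 0 ?xs (int (length ?xs)))"
    using snoc by (intro relpowp_Suc_I[OF relpowp_trans[OF snoc.IH guess_letter]]) auto
  moreover have "Suc (2 * length (word_code w) + (2 * a + 1)) = 2 * length ?xs"
    by (simp add: word_code_snoc)
  ultimately show ?case by metis
qed

text \<open>After the last letter the step to \<open>Guess\<close> is replaced by the step to
  \<open>Rewind\<close>, so writing still costs twice the length. Rewinding costs the length once
  more, and entering the simulation one step.\<close>

lemma guess_word:
  assumes "good w"
  shows "(step N ^^ (3 * length (word_code w) + 1)) (init_config N [input]) (sim (sim_input w))"
proof -
  obtain u a where w: "w = u @ [a]" using assms by (metis good_def rev_exhaust)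
  then have letters: "set u \<subseteq> {..<n}" "a < n" using assms by (auto simp: good_def)
  let ?xs = "word_code w"
  have len: "2 * length (word_code u) + (2 * a + 1) + 1 = 2 * length ?xs"
    by (simp add: w word_code_snoc)
  have "step N (conf Back (- 1) ?xs (int (length ?xs))) (conf Rewind 0 ?xs (int (length ?xs) - 1))"
    using tape_of_end[of ?xs "length ?xs"] tape_of_neg[of "- 1" input]
    by (intro guess_step[where q = Back and a = 0 and b = 0 and b' = 0])
      (auto simp: guess_rules_def fun_upd_idem)
  then have 1: "(step N ^^ Suc (2 * length (word_code u) + (2 * a + 1))) (conf Guess 0 [] 0)
      (conf Rewind 0 ?xs (int (length ?xs) - 1))"
    unfolding w by (intro relpowp_Suc_I[OF relpowp_trans[OF guess_prefix guess_letter]] letters)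
  have in0: "fst (tape_of input) 0 = 2" using tape_of_unary[of 0 n r] letters by simp
  have 2: "(step N ^^ j) (conf Rewind 0 ?xs (int j - 1)) (conf Rewind 0 ?xs (- 1))"
    if "j \<le> length ?xs" for j
    using that
  proof (induction j)
    case (Suc j)
    let ?b = "fst (tape_of ?xs) (int j)"
    have "?b \<in> {1, 2}" using tape_of_nth[of j ?xs] Suc.prems by simp
    then have "step N (conf Rewind 0 ?xs (int (Suc j) - 1)) (conf Rewind 0 ?xs (int j - 1))"
      using in0
      by (intro guess_step[where q = Rewind and a = 2 and b = ?b and b' = ?b])
        (auto simp: guess_rules_def fun_upd_idem)
    with Suc show ?case by (meson Suc_leD relpowp_Suc_I2)
  qed simp
  have 3: "step N (conf Rewind 0 ?xs (- 1)) (sim (sim_input w))"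
    unfolding init_sim[symmetric]
    using tape_of_neg[of "- 1" ?xs] in0
    by (intro guess_step[where q = Rewind and a = 2 and b = 0 and b' = 0])
      (auto simp: guess_rules_def fun_upd_idem)
  have "(step N ^^ Suc (Suc (2 * length (word_code u) + (2 * a + 1)) + length ?xs))
      (conf Guess 0 [] 0) (sim (sim_input w))"
    by (rule relpowp_Suc_I[OF relpowp_trans[OF 1 2[OF order.refl]] 3])
  moreover have "Suc (Suc (2 * length (word_code u) + (2 * a + 1)) + length ?xs) =
      3 * length ?xs + 1" using len by linarith
  ultimately show ?thesis unfolding init_guesser by metis
qed

text \<open>The halting and checking rules exist only for the finite sets of states and readings.
  This invariant of \<open>M\<close> guarantees that the rule required by a run is among
  them.\<close>

definition proper :: "config \<Rightarrow> bool" where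
  "proper c \<longleftrightarrow> fst c \<in> states M \<and> length (snd c) = tapes M \<and>
     (\<forall>t\<in>set (snd c). range (fst t) \<subseteq> symbols M)"

lemma proper_init: "proper (init_config M ins)"
  by (auto simp: proper_def init_config_def states_def symbols_def tape_of_def)

lemma written_symbol: "(q, rs, q', as) \<in> trans M \<Longrightarrow> (s, m) \<in> set as \<Longrightarrow> s \<in> symbols M"
  unfolding symbols_def by (intro UnI2 UN_I[of "(q, rs, q', as)"]) (auto intro: image_eqI[of _ _ "(s, m)"])

lemma proper_step:
  assumes "proper c" "step M c d"
  shows "proper d"
proof -
  obtain as where as: "(fst c, map (\<lambda>(t, p). t p) (snd c), fst d, as) \<in> trans M"
    and d: "snd d = map2 (\<lambda>(t, p) (s, d). (t(p := s), p + d)) (snd c) as"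
    using assms(2) by (auto simp: step_def)
  have "length as = tapes M" using wf_rule[OF as] by blast
  moreover have "range (fst t) \<subseteq> symbols M" if mem: "t \<in> set (snd d)" for t
  proof -
    obtain y where y: "y \<in> set (zip (snd c) as)"
      and t: "t = (case y of (x, y) \<Rightarrow> (case x of (t, p) \<Rightarrow> \<lambda>(s, d). (t(p := s), p + d)) y)"
      using mem unfolding d set_map by blast
    obtain t' p s m where [simp]: "y = ((t', p), (s, m))" by (cases y) auto
    have "(t', p) \<in> set (snd c)" using y by (auto dest: set_zip_leftD)
    then have "range t' \<subseteq> symbols M" using assms(1) unfolding proper_def by fastforce
    moreover have "s \<in> symbols M"
      using y by (intro written_symbol[OF as]) (auto dest: set_zip_rightD)
    ultimately show ?thesis by (auto simp: t)
  qed
  moreover have "fst d \<in> states M"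
    unfolding states_def by (rule insertI2, rule image_eqI[OF _ as]) simp
  ultimately show ?thesis using assms(1) d by (simp add: proper_def)
qed

lemma proper_readings: "proper c \<Longrightarrow> map (\<lambda>(t, p). t p) (snd c) \<in> readings M"
  by (force simp: proper_def readings_def)

lemma halt_step:
  assumes "proper c" "\<nexists>d. step M c d"
  shows "step N (sim c) (check 0 c)"
proof -
  let ?rs = "map (\<lambda>(t, p). t p) (snd c)"
  have no: "\<nexists>q' as. (fst c, ?rs, q', as) \<in> trans M"
  proof clarify
    fix q' as assume "(fst c, ?rs, q', as) \<in> trans M"
    then have "step M c (q', map2 (\<lambda>(t, p) (s, d). (t(p := s), p + d)) (snd c) as)"
      unfolding step_def fst_conv snd_conv by blast
    then show False using assms(2) by blast
  qed
  have "fst c \<in> states M" using assms(1) by (simp add: proper_def)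
  with no proper_readings[OF assms(1)]
  have mem: "(fst c, ?rs) \<in> {(q, rs) \<in> states M \<times> readings M. \<nexists>q' as. (q, rs, q', as) \<in> trans M}"
    by (simp only: mem_Collect_eq prod.case mem_Sigma_iff simp_thms)
  have "(to_nat (Sim (fst c)), ?rs, to_nat (Check 0), map (\<lambda>s. (s, 0)) ?rs) \<in> halt_rules M"
    unfolding halt_rules_def by (rule image_eqI[OF _ mem]) (simp only: prod.case)
  then have rule: "(to_nat (Sim (fst c)), ?rs, to_nat (Check 0), map (\<lambda>s. (s, 0)) ?rs) \<in> trans N"
    unfolding guesser_def tm.select_convs by (intro UnI1 UnI2)
  have "check 0 c = (to_nat (Check 0), snd c)" by (simp add: check_def)
  then show ?thesis
    unfolding step_def sim_def fst_conv snd_conv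
    by (intro exI[of _ "map (\<lambda>s. (s, 0)) ?rs"] conjI) (simp_all only: rule act_stay fst_conv snd_conv)
qed

lemma check_step:
  assumes "proper c" "snd c ! 2 = tape_of v" "i \<le> length v"
  shows "step N (check i c) (check (Suc i) c)"
proof -
  let ?ts = "snd (check i c)"
  let ?rs = "map (\<lambda>(t, p). t p) ?ts"
  have 2: "2 < length (snd c)" "2 < length ?ts"
    using assms(1) tapes by (auto simp: proper_def check_def)
  \<comment> \<open>Only a head position differs from \<open>c\<close>, so the tape contents remain
    over \<open>symbols M\<close>.\<close>
  have sub: "set ?ts \<subseteq> insert (fst (snd c ! 2), snd (snd c ! 2) + int i) (set (snd c))"
    unfolding check_def snd_conv by (rule set_update_subset_insert)
  have old: "range (fst t) \<subseteq> symbols M" if "t \<in> set (snd c)" for t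
    using assms(1) that unfolding proper_def by blast
  have "range (fst t) \<subseteq> symbols M" if "t \<in> set ?ts" for t
  proof -
    from sub that consider "t = (fst (snd c ! 2), snd (snd c ! 2) + int i)" | "t \<in> set (snd c)"
      by blast
    then show ?thesis using old nth_mem[OF 2(1)] by cases simp_all
  qed
  moreover have "fst c \<in> states M" "length ?ts = tapes M"
    using assms(1) by (simp_all add: proper_def check_def)
  ultimately have "proper (fst c, ?ts)" unfolding proper_def fst_conv snd_conv by blast
  then have readings: "?rs \<in> readings M" using proper_readings[of "(fst c, ?ts)"] unfolding snd_conv by blast
  have cell: "?rs ! 2 = fst (tape_of v) (int i)"
    using 2(1) assms(2) by (simp add: check_def) (simp add: tape_of_def)
  let ?as = "(map (\<lambda>s. (s, 0)) ?rs)[2 := (?rs ! 2, 1)]"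
  have "(to_nat (Check i), ?rs, to_nat (Check (Suc i)), ?as) \<in> check_rules M v"
    unfolding check_rules_def
  proof (rule image_eqI)
    show "(i, ?rs) \<in> {(i, rs) \<in> {..length v} \<times> readings M. rs ! 2 = fst (tape_of v) (int i)}"
      using readings cell assms(3)
      by (simp only: mem_Collect_eq prod.case mem_Sigma_iff atMost_iff simp_thms)
  qed (simp only: prod.case)
  then have rule: "(to_nat (Check i), ?rs, to_nat (Check (Suc i)), ?as) \<in> trans N"
    unfolding guesser_def tm.select_convs by (rule UnI2)
  have state: "fst (check j c) = to_nat (Check j)" for j by (simp add: check_def)
  have "snd (check (Suc i) c) = ?ts[2 := (fst (?ts ! 2), snd (?ts ! 2) + 1)]"
    using 2(1) by (simp add: check_def ac_simps)
  also have "\<dots> = map2 (\<lambda>(t, p) (s, d). (t(p := s), p + d)) ?ts ?as"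
    by (rule act_move_right[OF 2(2), symmetric])
  finally show ?thesis unfolding step_def state by (intro exI[of _ ?as] conjI rule)
qed

text \<open>The budget consists of \<open>3 * length (word_code w) + 1\<close> steps for guessing,
  at most \<open>t\<close> for the simulation, one for noticing the halt, and
  \<open>length v + 1\<close> for the comparison including the final blank.\<close>

lemma guesser_complete:
  assumes "good w" and run: "computes_within M [input, word_code w] v t"
  shows "accepts_within N input (3 * length (word_code w) + t + length v + 3)"
proof -
  obtain k c where k: "k \<le> t" and c: "(step M ^^ k) (sim_input w) c" "\<nexists>d. step M c d"
    "snd c ! 2 = tape_of v"
    using run by (auto simp: computes_within_def numeral_2_eq_2)
  have "proper c"
    using c(1) by (induction k arbitrary: c) (auto intro: proper_init proper_step)
  have check: "(step N ^^ i) (check 0 c) (check i c)" if "i \<le> Suc (length v)" for i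
    using that
  proof (induction i)
    case (Suc i)
    then show ?case using check_step[OF \<open>proper c\<close> c(3), of i] by auto
  qed simp
  define K where "K = Suc ((3 * length (word_code w) + 1) + k) + Suc (length v)"
  have "(step N ^^ K) (init_config N [input]) (check (Suc (length v)) c)"
    unfolding K_def
    by (rule relpowp_trans[OF relpowp_Suc_I[OF relpowp_trans[OF guess_word[OF assms(1)]
      sim_steps[OF c(1)]] halt_step[OF \<open>proper c\<close> c(2)]] check]) simp
  moreover have "fst (check (Suc (length v)) c) = accept N" by (simp add: check_def)
  moreover have "K \<le> 3 * length (word_code w) + t + length v + 3" using k by (simp add: K_def)
  ultimately show ?thesis unfolding accepts_within_def by blast
qed

end

subsection \<open>The time bound\<close>

lemma length_word_code: "set w \<subseteq> {..<n} \<Longrightarrow> length (word_code w) \<le> n * length w"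
proof (induction w)
  case (Cons a w)
  then have "Suc a + length (word_code w) \<le> n + n * length w" by (intro add_le_mono) auto
  then show ?case by (simp add: word_code_def unary_def)
qed (simp add: word_code_def)

lemma complexity_le_instance: "complexity T \<le> length (instance_code x T)"
  by (simp add: complexity_def instance_code_def unary_def)

lemma word_bound_mono: "c \<le> m \<Longrightarrow> word_bound c \<le> word_bound m"
  unfolding word_bound_def by (intro add_le_mono mult_le_mono power_mono) simp_all

text \<open>Here \<open>m\<close> stands for the input length, \<open>l\<close> for the length of
  the word code, \<open>k\<close> for the argument of the evaluator's time bound and
  \<open>e\<close> for the length of the expected output.\<close>

lemma guess_time_bound:
  fixes p :: "nat poly"
  shows "\<exists>q :: nat poly. \<forall>m l k e. l \<le> m * 2 ^ word_bound m \<longrightarrow> k \<le> m + 2 ^ word_bound m \<longrightarrow>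
    3 * l + poly p k + e + 3 \<le> 2 ^ (poly q m + e)"
proof -
  obtain a d where p: "\<And>m e. m \<le> 2 ^ e \<Longrightarrow> poly p m \<le> 2 ^ (a + d * e)"
    using poly_le_two_power[of p] by blast
  define X where "X = [:0, 1 :: nat:]"
  \<comment> \<open>The polynomial whose value at \<open>m\<close> is
    \<open>m + word_bound m\<close>.\<close>
  define K where "K = X + (X + X ^ 2 + (X + 1) * (X * (X ^ 2 * (X * (X + 1)))))"
  \<comment> \<open>Of the constant 6, three absorb the factor 8 that covers the sum of the terms,
    and three come from \<open>e + 3 \<le> 2 ^ (e + 3)\<close>.\<close>
  define q where "q = K + [:d:] * K + [:a + 6:]"
  have "3 * l + poly p k + e + 3 \<le> 2 ^ (poly q m + e)"
    if l: "l \<le> m * 2 ^ word_bound m" and k: "k \<le> m + 2 ^ word_bound m" for m l k e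
  proof -
    let ?B = "m + word_bound m"
    have "poly K m = ?B" by (simp add: K_def X_def word_bound_def algebra_simps)
    then have q: "poly q m = ?B + (a + d * ?B) + 6" by (simp add: q_def)
    have m: "m + 1 \<le> 2 ^ m" using less_exp[of m] by (simp add: Suc_le_eq)
    have "l \<le> 2 ^ m * 2 ^ word_bound m" using l m by (meson add_leD1 le_trans mult_le_mono1)
    then have l: "l \<le> 2 ^ ?B" by (simp add: power_add)
    have "k \<le> m * 1 + 2 ^ word_bound m" using k by simp
    also have "\<dots> \<le> m * 2 ^ word_bound m + 2 ^ word_bound m"
      by (intro add_le_mono mult_le_mono) simp_all
    also have "\<dots> = (m + 1) * 2 ^ word_bound m" by simp
    also have "\<dots> \<le> 2 ^ m * 2 ^ word_bound m" using m by (rule mult_le_mono1)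
    finally have "poly p k \<le> 2 ^ (a + d * ?B)" by (intro p) (simp add: power_add)
    moreover have "e + 3 \<le> 2 ^ (e + 3)" using less_exp[of "e + 3"] by simp
    moreover have "(2 :: nat) ^ ?B \<le> 2 ^ (?B + (a + d * ?B) + (e + 3))"
      "(2 :: nat) ^ (a + d * ?B) \<le> 2 ^ (?B + (a + d * ?B) + (e + 3))"
      "(2 :: nat) ^ (e + 3) \<le> 2 ^ (?B + (a + d * ?B) + (e + 3))"
      by (intro power_increasing; simp)+
    ultimately have "3 * l + poly p k + e + 3 \<le> 8 * 2 ^ (?B + (a + d * ?B) + (e + 3))"
      using l by linarith
    also have "\<dots> = 2 ^ (poly q m + e)"
      unfolding q by (simp add: power_add)
    finally show ?thesis .
  qed
  then show ?thesis by blast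
qed

theorem theorem4:
  fixes den :: "bool list \<rightharpoonup> fix_te"
  assumes "ran den \<subseteq> T_fix"
    and "poly_size den"
    and "poly_time_eval den"
  shows "trSat den \<in> NEXPTIME"
proof (cases "\<exists>x T. den x = Some T \<and> satisfiable T")
  \<comment> \<open>Split off because the number of tapes of the evaluator is known only from an
    actual run, hence from an instance with a word. Without yes-instances, a machine that never
    moves suffices.\<close>
  case False
  let ?M = "\<lparr>tapes = 1, start = 0, accept = 1, trans = {}\<rparr>"
  have "(step ?M ^^ k) c c' \<Longrightarrow> c' = c" for k c c'
    by (cases k) (auto simp: step_def)
  then have "\<not> accepts_within ?M x k" for x k
    by (fastforce simp: accepts_within_def init_config_def)
  moreover have "wf_tm ?M" by (simp add: wf_tm_def)
  ultimately show ?thesis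
    using False unfolding trSat_def NEXPTIME_def by blast
next
  case True
  obtain M num p where M: "wf_tm M" "deterministic M" "inj_on num \<rat>"
    and run: "\<And>x T w. den x = Some T \<Longrightarrow> w \<in> words T \<Longrightarrow>
      computes_within M [instance_code x T, word_code w] (num (fix_eval T w))
        (poly p (complexity T + length w))"
    using assms(3) unfolding poly_time_eval_def by blast
  obtain x T w where "den x = Some T" "w \<in> words T"
    using True by (auto simp: satisfiable_def)
  from run[OF this] have tapes: "3 \<le> tapes M" by (simp add: computes_within_def)
  have T_fix: "T \<in> T_fix" if "den x = Some T" for x T
    using assms(1) that by (auto simp: ran_def)
  \<comment> \<open>The guesser reads only the first unary block, the size of the alphabet; the
    remainder matters to the evaluator alone.\<close>
  define rest where "rest x T = concat (map unary [length (layers T), max_heads T, max_dim T,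
    period T, bits (arith T)]) @ x" for x and T :: fix_te
  have code: "instance_code x T = unary (alph_size T) @ rest x T" for x T
    by (simp add: instance_code_def rest_def)
  have loc: "guess_and_check M" using M(1) tapes by unfold_locales
  have good: "guess_and_check.good (alph_size T) w \<longleftrightarrow> w \<in> words T" for T :: fix_te and w
    by (auto simp: guess_and_check.good_def[OF loc] words_def)
  \<comment> \<open>\<open>num\<close> is common to all encoders of the class, so the string
    \<open>num 1\<close> can be built into a single machine.\<close>
  let ?G = "guesser M (num 1)"
  obtain q :: "nat poly" where q: "\<And>m l k e. l \<le> m * 2 ^ word_bound m \<Longrightarrow>
      k \<le> m + 2 ^ word_bound m \<Longrightarrow> 3 * l + poly p k + e + 3 \<le> 2 ^ (poly q m + e)"
    using guess_time_bound[of p] by blast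
  have "accepts_within ?G (instance_code x T)
      (2 ^ poly (q + [:length (num 1):]) (length (instance_code x T)))"
    if x: "den x = Some T" and sat: "satisfiable T" for x T
  proof -
    let ?m = "length (instance_code x T)"
    obtain w where w: "w \<in> words T" "fix_eval T w = 1"
      and short: "length w \<le> 2 ^ word_bound (complexity T)"
      using small_word[OF T_fix[OF x] sat] by blast
    have "accepts_within ?G (instance_code x T)
        (3 * length (word_code w) + poly p (complexity T + length w) + length (num 1) + 3)"
      using guess_and_check.guesser_complete[OF loc, of "alph_size T" w "rest x T"]
        run[OF x w(1)] w good code by simp
    moreover have "3 * length (word_code w) + poly p (complexity T + length w) + length (num 1) + 3
        \<le> 2 ^ (poly q ?m + length (num 1))"
    proof (rule q)
      have c: "complexity T \<le> ?m" by (rule complexity_le_instance)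
      then have "(2 :: nat) ^ word_bound (complexity T) \<le> 2 ^ word_bound ?m"
        by (intro power_increasing word_bound_mono) simp_all
      with short have len: "length w \<le> 2 ^ word_bound ?m" by (rule le_trans)
      then show "complexity T + length w \<le> ?m + 2 ^ word_bound ?m" using c by simp
      have "length (word_code w) \<le> alph_size T * length w"
        using w(1) by (intro length_word_code) (simp add: words_def)
      also have "\<dots> \<le> ?m * 2 ^ word_bound ?m"
        using len c by (intro mult_le_mono) (simp_all add: complexity_def)
      finally show "length (word_code w) \<le> ?m * 2 ^ word_bound ?m" .
    qed
    ultimately show ?thesis
      unfolding accepts_within_def by (simp, meson le_trans)
  qed
  moreover have "\<not> accepts_within ?G (instance_code x T) k"
    if x: "den x = Some T" and unsat: "\<not> satisfiable T" for x T k
  proof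
    assume "accepts_within ?G (instance_code x T) k"
    then obtain c where "(step ?G)\<^sup>*\<^sup>* (init_config ?G [instance_code x T]) c" "fst c = accept ?G"
      unfolding accepts_within_def by (meson relpowp_imp_rtranclp)
    then obtain w d where w: "w \<in> words T"
      and d: "(step M)\<^sup>*\<^sup>* (init_config M [instance_code x T, word_code w]) d" "\<nexists>e. step M d e"
      and match: "\<And>i. i \<le> length (num 1) \<Longrightarrow>
        fst (snd d ! 2) (snd (snd d ! 2) + int i) = fst (tape_of (num 1)) (int i)"
      using guess_and_check.guesser_sound[OF loc, of "num 1" "alph_size T" "rest x T" c] good code
      by metis
    obtain d' where d': "(step M)\<^sup>*\<^sup>* (init_config M [instance_code x T, word_code w]) d'"
      "\<nexists>e. step M d' e" "snd d' ! 2 = tape_of (num (fix_eval T w))"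
    proof -
      obtain j d' where "(step M ^^ j) (init_config M [instance_code x T, word_code w]) d'"
        "\<nexists>e. step M d' e" "snd d' ! 2 = tape_of (num (fix_eval T w))"
        using run[OF x w] by (auto simp: computes_within_def numeral_2_eq_2)
      then show ?thesis using that[OF relpowp_imp_rtranclp] by blast
    qed
    have "d = d'" using halting_unique[OF M(2) d d'(1,2)] .
    then have "snd d ! 2 = tape_of (num (fix_eval T w))" using d'(3) by simp
    \<comment> \<open>The cells were matched relative to the head of the output tape, which
      \<open>tape_of\<close> places on cell 0. Agreement up to and including the blank after
      \<open>num 1\<close> forces equal strings.\<close>
    then have "num (fix_eval T w) = num 1"
      using match by (intro tape_of_eqI) (simp add: tape_of_def)
    then have "fix_eval T w = 1"
      using inj_onD[OF M(3)] fix_eval_Rats[OF T_fix[OF x] w] Rats_1 by blast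
    then show False using unsat w by (auto simp: satisfiable_def)
  qed
  moreover have "wf_tm ?G" by (rule guess_and_check.wf_guesser[OF loc])
  ultimately show ?thesis unfolding trSat_def NEXPTIME_def by blast
qed

end
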